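(* Assume: (1) $w_0\in\mathcal K$ and $\epsilon_0\ge 0$ satisfy $F(w_0)-F_*\le\epsilon_0$; (2) there is $G>0$ such that $\|\partial f(w;\xi)\|_2\le G$ for all $w\in\mathcal K$; (3) for a target $0<\epsilon<1$ with $\epsilon^2<\epsilon_0$ there are $c>0$ and $\theta\in(0,1]$ such that $\|w-w_*\|_2\le c\,(F(w)-F_* )^{\theta}$ for all $w\in\mathcal S_{\epsilon^2}$, where $w_*$ is the point of $\mathcal K_*$ closest to $w$. Let $K=\lceil\log_2(\epsilon_0/\epsilon^2)\rceil$ and $\tilde\delta=\delta/K$. Suppose either (i) $\delta\in(0,1)$, $D_1\ge\frac{c\epsilon_0}{\epsilon^{2(1-\theta)}}$ with $D_1=O\big(\frac{c\epsilon_0}{\epsilon^{2(1-\theta)}}\big)$, $t$ is the smallest integer such that $t\ge\max\{9,1728\log(1/\tilde\delta)\}\frac{G^2D_1^2}{\epsilon_0^2}$, and $w_K$ is the output of ASSG-c$(w_0,K,t,D_1,\epsilon_0)$; or (ii) $\delta\in(0,1/e)$, $\beta_1\ge\frac{2c^2\epsilon_0}{\epsilon^{4(1-\theta)}}$ with $\beta_1=O\big(\frac{2c^2\epsilon_0}{\epsilon^{4(1-\theta)}}\big)$, $t$ is the smallest integer such that $t\ge\max\big\{3,\frac{136\beta_1G^2(1+\log(4\log t/\tilde\delta)+\log t)}{\epsilon_0}\big\}$, and $w_K$ is the output of ASSG-r with inputs $w_0,K,t,\epsilon_0,\beta_1$. Then with probability at least $1-\delta$, $$\|\nabla F_{1/4}(w_K)\|_2\le\epsilon,$$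 and the iteration complexity $Kt$ is $\widetilde O\big(1/\epsilon^{4(1-\theta)}\big)$.
   Context: Setting: $\mathcal K\subseteq\mathbb R^d$ is a nonempty closed convex set, $\xi$ is a random variable, $f(\cdot;\xi)$ is a real-valued convex function, $F(w)=\mathbb E_\xi[f(w;\xi)]$, $F_*=\min_{w\in\mathcal K}F(w)$, and $\mathcal K_*=\arg\min_{w\in\mathcal K}F(w)$ is nonempty. $\partial f(w;\xi)$ denotes a subgradient of $f(\cdot;\xi)$ at $w$ (with $\mathbb E_\xi[\partial f(w;\xi)]$ a subgradient of $F$ at $w$). $\mathcal S_\epsilon=\{w\in\mathcal K:F(w)\le F_*+\epsilon\}$. $\mathcal B(w,r)$ is the closed Euclidean ball and $\Pi_C$ is Euclidean projection onto $C$. $\log$ is the natural logarithm. Moreau envelope: for $\lambda>0$, $F_\lambda(w)=\min_{v\in\mathcal K}\{F(v)+\frac\lambda2\|v-w\|_2^2\}$, a differentiable function with $\nabla F_\lambda(w)=\lambda(w-\widetilde w)$ where $\widetilde w=\arg\min_{v\in\mathcal K}\{F(v)+\frac\lambda2\|v-w\|_2^2\}$. $F_{1/4}$ is $F_\lambda$ with $\lambda=1/4$. Algorithm ASSG-c$(w_0,K,t,D_1,\epsilon_0)$: set $\eta_1=\epsilon_0/(3G^2)$. For $k=1,\dots,K$: let $w_1^k=w_{k-1}$; for $\tau=1,\dots,t-1$ let $w^k_{\tau+1}=\Pi_{\mathcal K\cap\mathcal B(w_{k-1},D_k)}[w^k_\tau-\eta_k\,\partial f(w^k_\tau;\xi^k_\tau)]$;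 let $w_k=\frac1t\sum_{\tau=1}^tw^k_\tau$, $\eta_{k+1}=\eta_k/2$, $D_{k+1}=D_k/2$. Output $w_K$. Algorithm ASSG-r: For $k=1,\dots,K$: let $w_1^k=w_{k-1}$; for $\tau=1,\dots,t-1$ let $w'_{\tau+1}=(1-\frac2\tau)w^k_\tau+\frac2\tau w^k_1-\frac{2\beta_k}{\tau}\partial f(w^k_\tau;\xi^k_\tau)$ and $w^k_{\tau+1}=\Pi_{\mathcal K}[w'_{\tau+1}]$; let $w_k=\frac1t\sum_{\tau=1}^tw^k_\tau$ and $\beta_{k+1}=\beta_k/2$. Output $w_K$. In both, the $\xi^k_\tau$ are independent copies of $\xi$, and each stage counts as $t$ iterations. $\widetilde O$ suppresses constants depending on the problem parameters and factors (poly)logarithmic in $1/\epsilon$ and $1/\delta$. *)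

theory Defs
  imports "HOL-Probability.Probability"
begin

definition is_subgradient_on :: "'a::real_inner set \<Rightarrow> ('a \<Rightarrow> real) \<Rightarrow> 'a \<Rightarrow> 'a \<Rightarrow> bool" where
  "is_subgradient_on S h w v \<longleftrightarrow> (\<forall>u\<in>S. h u \<ge> h w + v \<bullet> (u - w))"

definition argmin_set :: "('a \<Rightarrow> real) \<Rightarrow> 'a set \<Rightarrow> 'a set" where
  "argmin_set F \<K> = {w. is_arg_min F (\<lambda>v. v \<in> \<K>) w}"

definition min_value :: "('a \<Rightarrow> real) \<Rightarrow> 'a set \<Rightarrow> real" where
  "min_value F \<K> = (INF w\<in>\<K>. F w)"

definition eps_sublevel_set :: "('a \<Rightarrow> real) \<Rightarrow> 'a set \<Rightarrow> real \<Rightarrow> 'a set" where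
  "eps_sublevel_set F \<K> \<epsilon> = {w \<in> \<K>. F w \<le> min_value F \<K> + \<epsilon>}"

definition local_error_bound ::
  "('a::euclidean_space \<Rightarrow> real) \<Rightarrow> 'a set \<Rightarrow> real \<Rightarrow> real \<Rightarrow> real \<Rightarrow> bool" where
  "local_error_bound F \<K> \<epsilon> c \<theta> \<longleftrightarrow>
     (\<forall>w \<in> eps_sublevel_set F \<K> \<epsilon>.
        norm (w - closest_point (argmin_set F \<K>) w) \<le> c * (F w - min_value F \<K>) powr \<theta>)"

text \<open>
  The infimum is attained when \<open>\<K>\<close> is nonempty, closed and convex, \<open>\<rho> > 0\<close>, and \<open>F\<close> is convex
  and continuous on \<open>\<K>\<close>, so it is then the minimum.
\<close>

definition moreau_envelope ::
  "('a::real_inner \<Rightarrow> real) \<Rightarrow> 'a set \<Rightarrow> real \<Rightarrow> 'a \<Rightarrow> real" where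
  "moreau_envelope F \<K> \<rho> w = (INF v\<in>\<K>. F v + \<rho> / 2 * (norm (v - w))\<^sup>2)"

definition iid_copies :: "'w measure \<Rightarrow> 's measure \<Rightarrow> ('i \<Rightarrow> 'w \<Rightarrow> 's) \<Rightarrow> 'i set \<Rightarrow> bool" where
  "iid_copies M D X I \<longleftrightarrow>
     prob_space.indep_vars M (\<lambda>_. D) X I \<and> (\<forall>i\<in>I. distr M D (X i) = D)"

text \<open>
  Both algorithms are defined pathwise: \<open>g w s\<close> is the stochastic subgradient oracle,
  \<open>z \<tau>\<close> is the sample drawn in step \<open>\<tau>\<close> of a stage and \<open>\<xi> (k, \<tau>)\<close> the one drawn in
  step \<open>\<tau>\<close> of stage \<open>k\<close>. Stages and steps are numbered from 1, so the iterates of a stage are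
  the values at \<open>\<tau> = 1, \<dots>, t\<close>, the first being \<open>w1\<close>; the value at \<open>\<tau> = 0\<close> is a dummy.
\<close>

primrec assg_c_iterate ::
  "('a::euclidean_space \<Rightarrow> 's \<Rightarrow> 'a) \<Rightarrow> 'a set \<Rightarrow> real \<Rightarrow> (nat \<Rightarrow> 's) \<Rightarrow> 'a \<Rightarrow> nat \<Rightarrow> 'a" where
  "assg_c_iterate g C \<eta> z w1 0 = w1"
| "assg_c_iterate g C \<eta> z w1 (Suc \<tau>) =
     (if \<tau> = 0 then w1
      else closest_point C
        (assg_c_iterate g C \<eta> z w1 \<tau> - \<eta> *\<^sub>R g (assg_c_iterate g C \<eta> z w1 \<tau>) (z \<tau>)))"

text \<open>
  Stage \<open>Suc k\<close> uses the radius \<open>D1 / 2 ^ k\<close> and the step size \<open>\<epsilon>0 / (3 G\<^sup>2) / 2 ^ k\<close>.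
\<close>

primrec assg_c ::
  "('a::euclidean_space \<Rightarrow> 's \<Rightarrow> 'a) \<Rightarrow> 'a set \<Rightarrow> real \<Rightarrow> 'a \<Rightarrow> nat \<Rightarrow> nat \<Rightarrow> real \<Rightarrow> real
     \<Rightarrow> (nat \<times> nat \<Rightarrow> 's) \<Rightarrow> 'a" where
  "assg_c g \<K> G w0 0 t D1 \<epsilon>0 \<xi> = w0"
| "assg_c g \<K> G w0 (Suc k) t D1 \<epsilon>0 \<xi> =
     (let w1 = assg_c g \<K> G w0 k t D1 \<epsilon>0 \<xi>;
          C = \<K> \<inter> cball w1 (D1 / 2 ^ k);
          \<eta> = \<epsilon>0 / (3 * G\<^sup>2) / 2 ^ k
      in (1 / real t) *\<^sub>R
           (\<Sum>\<tau>=1..t. assg_c_iterate g C \<eta> (\<lambda>\<tau>. \<xi> (Suc k, \<tau>)) w1 \<tau>))"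

primrec assg_r_iterate ::
  "('a::euclidean_space \<Rightarrow> 's \<Rightarrow> 'a) \<Rightarrow> 'a set \<Rightarrow> real \<Rightarrow> (nat \<Rightarrow> 's) \<Rightarrow> 'a \<Rightarrow> nat \<Rightarrow> 'a" where
  "assg_r_iterate g \<K> \<beta> z w1 0 = w1"
| "assg_r_iterate g \<K> \<beta> z w1 (Suc \<tau>) =
     (if \<tau> = 0 then w1
      else closest_point \<K>
        ((1 - 2 / real \<tau>) *\<^sub>R assg_r_iterate g \<K> \<beta> z w1 \<tau> + (2 / real \<tau>) *\<^sub>R w1
          - (2 * \<beta> / real \<tau>) *\<^sub>R g (assg_r_iterate g \<K> \<beta> z w1 \<tau>) (z \<tau>)))"

primrec assg_r ::
  "('a::euclidean_space \<Rightarrow> 's \<Rightarrow> 'a) \<Rightarrow> 'a set \<Rightarrow> 'a \<Rightarrow> nat \<Rightarrow> nat \<Rightarrow> real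
     \<Rightarrow> (nat \<times> nat \<Rightarrow> 's) \<Rightarrow> 'a" where
  "assg_r g \<K> w0 0 t \<beta>1 \<xi> = w0"
| "assg_r g \<K> w0 (Suc k) t \<beta>1 \<xi> =
     (let w1 = assg_r g \<K> w0 k t \<beta>1 \<xi>
      in (1 / real t) *\<^sub>R
           (\<Sum>\<tau>=1..t. assg_r_iterate g \<K> (\<beta>1 / 2 ^ k) (\<lambda>\<tau>. \<xi> (Suc k, \<tau>)) w1 \<tau>))"

end

theory Submission
  imports Defs
begin

text \<open>
  Write \<open>Fmin\<close> for the minimum of \<open>F\<close> on \<open>\<K>\<close> and \<open>a = \<epsilon>\<^sup>2\<close>. For the envelope with parameter \<open>l\<close>, whose
  gradient at \<open>w\<close> is \<open>l (w - p)\<close> with the proximal point \<open>p\<close> of \<open>w\<close>, the definition of \<open>p\<close> gives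
  \<open>l / 2 * (norm (w - p))\<^sup>2 \<le> F w - Fmin\<close>. So the squared gradient norm is at most \<open>2 l (F w - Fmin)\<close>, and for
  \<open>l = 1/4\<close> it suffices that the output has gap \<open>F w - Fmin \<le> 2 a\<close>.

  Both algorithms maintain the invariant that \<open>w\<^sub>k\<close> has gap at most \<open>a + \<epsilon>0 / 2 ^ k\<close>
  (\<open>level_halving\<close>); after \<open>K\<close> stages the second summand is at most \<open>a\<close>. A stage compares its average
  with the point \<open>u\<close> of the sublevel set of height \<open>a\<close> that is closest to \<open>w\<^sub>k\<close>. The growth condition on
  this sublevel set and convexity bound \<open>norm (w\<^sub>k - u)\<close> by \<open>c (\<epsilon>0 / 2 ^ k) a powr (\<theta> - 1)\<close>
  (\<open>dist_sublevel_le\<close>), and the radii and regularisation parameters are chosen to dominate this bound.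

  The regret of a stage against \<open>u\<close> consists of deterministic terms
  (\<open>projected_subgradient_regret\<close>, \<open>regularized_subgradient_regret\<close>) and of the sum of the martingale
  differences \<open>Z\<^sub>\<tau> = (h (w\<^sub>\<tau>) - g (w\<^sub>\<tau>, \<xi>\<^sub>\<tau>)) \<bullet> (w\<^sub>\<tau> - u)\<close>, where \<open>h\<close> is the mean subgradient. By
  Hoeffding's lemma, conditionally on the past,
  \<open>exp (s Z\<^sub>\<tau> - s\<^sup>2 G\<^sup>2 / 2 * (norm (w\<^sub>\<tau> - u))\<^sup>2)\<close> has mean at most 1, so the exponential of the sum over a
  stage has mean at most 1 (\<open>exponential_supermartingale\<close>), and outside an event of probability
  \<open>\<delta> / K\<close> the sum of the exponents stays below \<open>ln (K / \<delta>)\<close>. What remains is the quadratic compensator. In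
  ASSG-c it is bounded because the iterates stay in a ball. In ASSG-r the choice
  \<open>s = 1 / (2 \<beta> G\<^sup>2)\<close> makes it equal to the quadratic term gained from the strong convexity of the
  regularised objective, so it cancels.

  The stage lengths in the theorem are at least what these estimates ask for, and they are of order
  \<open>1 / \<epsilon> powr (4 * (1 - \<theta>))\<close> up to logarithms. For ASSG-r, where the length is the least solution of an
  inequality that contains its own logarithm, this follows from an explicit solution
  (\<open>log_fixpoint_step\<close>).
\<close>

section \<open>Projection onto balls with moving centre\<close>

text \<open>
  Moving the centre of the ball inside \<open>K\<close> by \<open>d\<close> moves the set \<open>K \<inter> cball w r\<close> by at most \<open>d\<close> in the
  Hausdorff sense: pulling \<open>p\<close> towards the new centre by the fraction \<open>d / (r + d)\<close> shrinks its
  distance from at most \<open>r + d\<close> to at most \<open>r\<close>.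
\<close>

lemma cball_shift_center:
  fixes K :: "'a::real_normed_vector set"
  assumes "convex K" "w' \<in> K" "r > 0" and p: "p \<in> K \<inter> cball w r"
  shows "\<exists>q \<in> K \<inter> cball w' r. norm (q - p) \<le> norm (w - w')"
proof -
  define d where "d = norm (w - w')"
  define s where "s = d / (r + d)"
  define q where "q = (1 - s) *\<^sub>R p + s *\<^sub>R w'"
  have d: "d \<ge> 0" "r + d > 0" using \<open>r > 0\<close> by (auto simp: d_def intro: add_pos_nonneg)
  have s: "0 \<le> s" "s \<le> 1" "s * (r + d) = d" "(1 - s) * (r + d) = r"
    using d \<open>r > 0\<close> by (auto simp: s_def field_simps)
  have pw: "norm (p - w') \<le> r + d"
    using norm_triangle_ineq[of "p - w" "w - w'"] p
    by (simp add: d_def dist_norm norm_minus_commute)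
  have "q \<in> K"
    using \<open>convex K\<close> p \<open>w' \<in> K\<close> s unfolding q_def by (auto intro!: convexD_alt)
  moreover have "norm (q - w') \<le> r"
  proof -
    have "q - w' = (1 - s) *\<^sub>R (p - w')" by (simp add: q_def algebra_simps)
    then have "norm (q - w') = (1 - s) * norm (p - w')" using s by simp
    also have "\<dots> \<le> (1 - s) * (r + d)" using pw s by (intro mult_left_mono) auto
    finally show ?thesis using s by simp
  qed
  moreover have "norm (q - p) \<le> d"
  proof -
    have "q - p = - (s *\<^sub>R (p - w'))" by (simp add: q_def algebra_simps)
    then have "norm (q - p) = s * norm (p - w')" using s by simp
    also have "\<dots> \<le> s * (r + d)" using pw s by (intro mult_left_mono) auto
    finally show ?thesis using s by simp
  qed
  ultimately show ?thesis by (auto simp: d_def dist_norm norm_minus_commute)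
qed

text \<open>
  The obtuse-angle characterisation of a projection is tested with a point of the own set that is
  close to the other projection; such a point exists by the preceding lemma. Adding the two
  inequalities gives \<open>a\<^sup>2 \<le> b a + e\<close> for the distance \<open>a\<close> of the projections, hence \<open>a \<le> b + sqrt e\<close>.
\<close>

lemma closest_point_moving_cball_diff:
  fixes K :: "'a::euclidean_space set" and x x' :: 'a
  assumes K: "closed K" "convex K" "w \<in> K" "w' \<in> K" "r > 0"
  defines "p \<equiv> closest_point (K \<inter> cball w r) x"
    and "p' \<equiv> closest_point (K \<inter> cball w' r) x'"
  shows "norm (p - p') \<le> norm (x - x')
           + sqrt (norm (w - w') * (norm (x - w) + norm (x' - w')))"
proof -
  define d where "d = norm (w - w')"
  have C: "closed (K \<inter> cball v r)" "convex (K \<inter> cball v r)" for v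
    using K by (auto intro: closed_Int convex_Int)
  have ne: "w \<in> K \<inter> cball w r" "w' \<in> K \<inter> cball w' r" using K by auto
  have p: "p \<in> K \<inter> cball w r" and p': "p' \<in> K \<inter> cball w' r"
    unfolding p_def p'_def
    using closest_point_in_set[OF C(1), of w x] closest_point_in_set[OF C(1), of w' x'] ne
    by blast+
  obtain q where q: "q \<in> K \<inter> cball w' r" "norm (q - p) \<le> d"
    using cball_shift_center[OF K(2,4,5) p] d_def by auto
  obtain q' where q': "q' \<in> K \<inter> cball w r" "norm (q' - p') \<le> d"
    using cball_shift_center[OF K(2,3,5) p'] d_def by (auto simp: norm_minus_commute)
  have 1: "(x - p) \<bullet> (q' - p) \<le> 0"
    unfolding p_def using C q' by (intro closest_point_dot) auto
  have 2: "(x' - p') \<bullet> (q - p') \<le> 0"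
    unfolding p'_def using C q by (intro closest_point_dot) auto
  have xp: "norm (x - p) \<le> norm (x - w)" "norm (x' - p') \<le> norm (x' - w')"
    using closest_point_le[OF C(1) ne(1), of x] closest_point_le[OF C(1) ne(2), of x']
    by (auto simp: p_def p'_def dist_norm)
  have b1: "- ((x - p) \<bullet> (q' - p')) \<le> norm (x - w) * d"
  proof -
    have "- ((x - p) \<bullet> (q' - p')) \<le> norm (x - p) * norm (q' - p')"
      using Cauchy_Schwarz_ineq2[of "x - p" "q' - p'"] by linarith
    also have "\<dots> \<le> norm (x - w) * d" using xp q' by (intro mult_mono) auto
    finally show ?thesis .
  qed
  have b2: "- ((x' - p') \<bullet> (q - p)) \<le> norm (x' - w') * d"
  proof -
    have "- ((x' - p') \<bullet> (q - p)) \<le> norm (x' - p') * norm (q - p)"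
      using Cauchy_Schwarz_ineq2[of "x' - p'" "q - p"] by linarith
    also have "\<dots> \<le> norm (x' - w') * d" using xp q by (intro mult_mono) auto
    finally show ?thesis .
  qed
  define a where "a = norm (p - p')"
  define b where "b = norm (x - x')"
  define e where "e = d * (norm (x - w) + norm (x' - w'))"
  have "a\<^sup>2 = (x - x') \<bullet> (p - p') + (x - p) \<bullet> (p' - p) + (x' - p') \<bullet> (p - p')"
    unfolding a_def power2_norm_eq_inner by (simp add: inner_diff inner_commute)
  also have "(x - p) \<bullet> (p' - p) = (x - p) \<bullet> (q' - p) - (x - p) \<bullet> (q' - p')"
    by (simp add: inner_diff)
  also have "(x' - p') \<bullet> (p - p') = (x' - p') \<bullet> (q - p') - (x' - p') \<bullet> (q - p)"
    by (simp add: inner_diff)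
  finally have "a\<^sup>2 \<le> (x - x') \<bullet> (p - p') + e"
    using 1 2 b1 b2 by (simp add: e_def algebra_simps)
  also have "(x - x') \<bullet> (p - p') \<le> b * a"
    unfolding a_def b_def by (rule norm_cauchy_schwarz)
  finally have ab: "a\<^sup>2 \<le> b * a + e" by simp
  have nn: "a \<ge> 0" "b \<ge> 0" "e \<ge> 0" by (auto simp: a_def b_def e_def d_def)
  have "a \<le> b + sqrt e"
  proof (rule ccontr)
    assume "\<not> ?thesis"
    then have gt: "a - b > sqrt e" by simp
    have "sqrt e \<ge> 0" using nn by simp
    then have ge: "a - b \<ge> 0" using gt by linarith
    have "e = sqrt e * sqrt e" using nn by simp
    also have "\<dots> < (a - b) * (a - b)"
      using gt ge \<open>sqrt e \<ge> 0\<close> by (intro mult_strict_mono') auto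
    also have "\<dots> \<le> (a - b) * a" using ge nn by (intro mult_left_mono) auto
    finally show False using ab by (simp add: power2_eq_square algebra_simps)
  qed
  then show ?thesis by (simp add: a_def b_def e_def d_def)
qed

lemma continuous_on_closest_point_moving_cball:
  fixes K :: "'a::euclidean_space set"
  assumes K: "closed K" "convex K" "r > 0"
  shows "continuous_on (K \<times> UNIV) (\<lambda>(w, x). closest_point (K \<inter> cball w r) x)"
  unfolding continuous_on_def
proof
  fix z assume z: "z \<in> K \<times> (UNIV :: 'a set)"
  let ?P = "\<lambda>(w, x). closest_point (K \<inter> cball w r) x"
  let ?e = "\<lambda>y. norm (snd y - snd z) + sqrt (norm (fst y - fst z)
           * (norm (snd y - fst y) + norm (snd z - fst z)))"
  have "(?e \<longlongrightarrow> norm (snd z - snd z) + sqrt (norm (fst z - fst z)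
           * (norm (snd z - fst z) + norm (snd z - fst z)))) (at z within K \<times> UNIV)"
    by (intro tendsto_intros)
  then have "(?e \<longlongrightarrow> 0) (at z within K \<times> UNIV)" by simp
  moreover have "\<forall>\<^sub>F y in at z within K \<times> UNIV. norm (?P y - ?P z) \<le> ?e y"
    unfolding eventually_at_filter
    by (rule always_eventually)
      (use z K in \<open>auto intro!: closest_point_moving_cball_diff\<close>)
  ultimately have "((\<lambda>y. ?P y - ?P z) \<longlongrightarrow> 0) (at z within K \<times> UNIV)"
    by (rule Lim_null_comparison[rotated])
  then show "(?P \<longlongrightarrow> ?P z) (at z within K \<times> UNIV)" by (rule Lim_null[THEN iffD2])
qed

text \<open>
  A stage of ASSG-c projects onto a ball around its random starting point, so measurability of the
  iterates needs the joint dependence on centre and argument.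
\<close>

lemma borel_measurable_closest_point_moving_cball:
  fixes K :: "'a::euclidean_space set"
  assumes "closed K" "convex K" "r > 0"
    and W: "W \<in> borel_measurable N" and X: "X \<in> borel_measurable N"
    and WK: "\<And>\<omega>. \<omega> \<in> space N \<Longrightarrow> W \<omega> \<in> K"
  shows "(\<lambda>\<omega>. closest_point (K \<inter> cball (W \<omega>) r) (X \<omega>)) \<in> borel_measurable N"
proof -
  have "(\<lambda>\<omega>. (W \<omega>, X \<omega>)) \<in> borel_measurable N"
    using W X by measurable
  then have "(\<lambda>\<omega>. (W \<omega>, X \<omega>)) \<in> measurable N (restrict_space borel (K \<times> UNIV))"
    by (rule measurable_restrict_space2[rotated]) (use WK in auto)
  from measurable_comp[OF this borel_measurable_continuous_on_restrict
      [OF continuous_on_closest_point_moving_cball[OF assms(1-3)]]]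
  show ?thesis by (simp add: comp_def)
qed

section \<open>Growth and Moreau envelope of a convex objective with bounded subgradients\<close>

text \<open>
  Only values on \<open>\<K>\<close> matter: a subgradient selection \<open>h\<close> bounded by \<open>G\<close> already makes \<open>F\<close> convex and
  \<open>G\<close>-Lipschitz there.
\<close>

locale bounded_subgradient =
  fixes \<K> :: "'a::euclidean_space set" and F :: "'a \<Rightarrow> real" and h :: "'a \<Rightarrow> 'a" and G :: real
  assumes K_closed: "closed \<K>" and K_convex: "convex \<K>"
    and argmin_nonempty: "argmin_set F \<K> \<noteq> {}"
    and subgradient: "w \<in> \<K> \<Longrightarrow> is_subgradient_on \<K> F w (h w)"
    and norm_subgradient_le: "w \<in> \<K> \<Longrightarrow> norm (h w) \<le> G"
begin

abbreviation Fmin :: real where "Fmin \<equiv> min_value F \<K>"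

lemma subgradient_ineq: "w \<in> \<K> \<Longrightarrow> u \<in> \<K> \<Longrightarrow> F w - F u \<le> h w \<bullet> (w - u)"
  using subgradient[of w] unfolding is_subgradient_on_def by (auto simp: inner_diff)

lemma min_value_eq: "x \<in> argmin_set F \<K> \<Longrightarrow> Fmin = F x"
  unfolding argmin_set_def min_value_def is_arg_min_linorder
  by (auto intro!: cInf_eq_minimum)

lemma min_value_le: "w \<in> \<K> \<Longrightarrow> Fmin \<le> F w"
  using argmin_nonempty min_value_eq
  by (fastforce simp: argmin_set_def is_arg_min_linorder)

lemma argmin_set_eq_sublevel: "argmin_set F \<K> = eps_sublevel_set F \<K> 0"
proof -
  obtain x where x: "x \<in> argmin_set F \<K>" using argmin_nonempty by auto
  have "w \<in> argmin_set F \<K> \<longleftrightarrow> w \<in> \<K> \<and> F w \<le> Fmin" for w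
  proof
    assume w: "w \<in> argmin_set F \<K>"
    then show "w \<in> \<K> \<and> F w \<le> Fmin"
      using min_value_eq[OF w] by (simp add: argmin_set_def is_arg_min_linorder)
  next
    assume w: "w \<in> \<K> \<and> F w \<le> Fmin"
    then have "F w \<le> F v" if "v \<in> \<K>" for v using min_value_le[OF that] by linarith
    with w show "w \<in> argmin_set F \<K>" by (simp add: argmin_set_def is_arg_min_linorder)
  qed
  then show ?thesis by (auto simp: eps_sublevel_set_def)
qed

lemma K_nonempty: "\<K> \<noteq> {}"
  using argmin_nonempty by (auto simp: argmin_set_def is_arg_min_linorder)

lemma lipschitz: "G-lipschitz_on \<K> F"
proof -
  have *: "F x - F y \<le> G * norm (x - y)" if "x \<in> \<K>" "y \<in> \<K>" for x y
  proof -
    have "F x - F y \<le> norm (h x) * norm (x - y)"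
      using subgradient_ineq[OF that] norm_cauchy_schwarz[of "h x" "x - y"] by linarith
    also have "\<dots> \<le> G * norm (x - y)"
      using norm_subgradient_le[OF that(1)] by (intro mult_right_mono) auto
    finally show ?thesis .
  qed
  obtain x where "x \<in> \<K>" using K_nonempty by auto
  then have "0 \<le> G" using norm_subgradient_le[of x] norm_ge_zero[of "h x"] by linarith
  moreover have "dist (F x) (F y) \<le> G * dist x y" if "x \<in> \<K>" "y \<in> \<K>" for x y
    using *[OF that] *[OF that(2,1)] by (auto simp: dist_norm norm_minus_commute abs_le_iff)
  ultimately show ?thesis by (auto simp: lipschitz_on_def)
qed

lemma continuous_on_F: "continuous_on \<K> F"
  using lipschitz by (rule lipschitz_on_continuous_on)

lemma convex_on_F: "convex_on \<K> F"
proof (rule convex_onI[OF _ K_convex])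
  fix s :: real and x y assume s: "0 < s" "s < 1" and xy: "x \<in> \<K>" "y \<in> \<K>"
  define z where "z = (1 - s) *\<^sub>R x + s *\<^sub>R y"
  have z: "z \<in> \<K>" unfolding z_def using K_convex xy s by (auto intro!: convexD_alt)
  have "(1 - s) * (F z - F x) + s * (F z - F y) \<le> (1 - s) * (h z \<bullet> (z - x)) + s * (h z \<bullet> (z - y))"
    using s subgradient_ineq[OF z xy(1)] subgradient_ineq[OF z xy(2)]
    by (intro add_mono mult_left_mono) auto
  also have "\<dots> = h z \<bullet> (z - z)"
    by (simp add: z_def inner_diff inner_add algebra_simps)
  finally show "F ((1 - s) *\<^sub>R x + s *\<^sub>R y) \<le> (1 - s) * F x + s * F y"
    by (simp add: z_def algebra_simps)
qed

lemma closed_sublevel: "closed (eps_sublevel_set F \<K> a)"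
proof -
  have "closed (\<K> \<inter> F -` {.. Fmin + a})"
    using continuous_on_F K_closed by (intro continuous_closed_preimage) auto
  moreover have "\<K> \<inter> F -` {.. Fmin + a} = eps_sublevel_set F \<K> a"
    by (auto simp: eps_sublevel_set_def)
  ultimately show ?thesis by simp
qed

lemma convex_sublevel: "convex (eps_sublevel_set F \<K> a)"
proof (rule convexI)
  fix x y and u v :: real
  assume xy: "x \<in> eps_sublevel_set F \<K> a" "y \<in> eps_sublevel_set F \<K> a" and uv: "0 \<le> u" "0 \<le> v" "u + v = 1"
  have "F (u *\<^sub>R x + v *\<^sub>R y) \<le> u * F x + v * F y"
    using convex_on_F xy uv by (auto simp: convex_on_def eps_sublevel_set_def)
  also have "\<dots> \<le> u * (Fmin + a) + v * (Fmin + a)"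
    using xy uv by (intro add_mono mult_left_mono) (auto simp: eps_sublevel_set_def)
  also have "\<dots> = Fmin + a" using uv by (simp flip: distrib_right)
  finally show "u *\<^sub>R x + v *\<^sub>R y \<in> eps_sublevel_set F \<K> a"
    using K_convex xy uv by (auto simp: eps_sublevel_set_def intro: convexD)
qed

lemma sublevel_nonempty: "a \<ge> 0 \<Longrightarrow> eps_sublevel_set F \<K> a \<noteq> {}"
  using argmin_nonempty unfolding argmin_set_eq_sublevel by (fastforce simp: eps_sublevel_set_def)

text \<open>
  The growth condition holds only on the sublevel set of height \<open>a\<close>, yet it controls the distance of
  points outside to that set. Let \<open>u\<close> be the projection of \<open>w\<close>, \<open>q\<close> an optimum nearest to \<open>u\<close>, and
  \<open>d > a\<close> the gap of \<open>w\<close>. By convexity the point \<open>z\<close> that divides the segment from \<open>w\<close> to \<open>q\<close> in the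
  ratio \<open>d - a : a\<close> lies in the sublevel set, so \<open>norm (w - u) \<le> norm (w - z)\<close>, which is
  \<open>(d - a) / d * norm (w - q)\<close>. Splitting \<open>norm (w - q)\<close> at \<open>u\<close> leaves
  \<open>norm (w - u) \<le> (d - a) / a * norm (u - q)\<close>, and \<open>norm (u - q) \<le> c * a powr \<theta>\<close> by the growth condition.
\<close>

lemma dist_sublevel_le:
  assumes w: "w \<in> \<K>" and "a > 0"
    and eb: "local_error_bound F \<K> a c \<theta>" and gap: "F w - Fmin \<le> a + e" and "e \<ge> 0" "c > 0" "\<theta> > 0"
  shows "norm (w - closest_point (eps_sublevel_set F \<K> a) w) \<le> c * e * a powr (\<theta> - 1)"
proof (cases "w \<in> eps_sublevel_set F \<K> a")
  case True
  then show ?thesis using assms by (simp add: closest_point_self)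
next
  case False
  let ?S = "eps_sublevel_set F \<K> a"
  define u where "u = closest_point ?S w"
  define q where "q = closest_point (argmin_set F \<K>) u"
  have u: "u \<in> ?S"
    unfolding u_def using closed_sublevel sublevel_nonempty \<open>a > 0\<close> by (intro closest_point_in_set) auto
  have q: "q \<in> argmin_set F \<K>"
    unfolding q_def argmin_set_eq_sublevel
    using closed_sublevel sublevel_nonempty by (intro closest_point_in_set) auto
  then have qK: "q \<in> \<K>" "F q = Fmin" using min_value_eq by (auto simp: argmin_set_def is_arg_min_linorder)
  define d where "d = F w - Fmin"
  have d: "d > a" using False w by (auto simp: eps_sublevel_set_def d_def)
  define m where "m = 1 - a / d"
  have m: "0 \<le> m" "m \<le> 1" "(1 - m) * d = a" using d \<open>a > 0\<close> by (auto simp: m_def)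
  define z where "z = (1 - m) *\<^sub>R w + m *\<^sub>R q"
  have "F z \<le> (1 - m) * F w + m * F q"
    unfolding z_def using convex_onD[OF convex_on_F, of m w q] m w qK by auto
  also have "\<dots> = Fmin + (1 - m) * d" unfolding d_def qK by (simp add: algebra_simps)
  finally have "z \<in> ?S"
    using m K_convex w qK by (auto simp: eps_sublevel_set_def z_def intro!: convexD_alt)
  then have "norm (w - u) \<le> norm (w - z)"
    using closest_point_le[OF closed_sublevel, of z a w] by (simp add: u_def dist_norm)
  also have "w - z = m *\<^sub>R (w - q)" by (simp add: z_def algebra_simps)
  also have "norm (m *\<^sub>R (w - q)) \<le> m * (norm (w - u) + norm (u - q))"
    using m norm_triangle_ineq[of "w - u" "u - q"] by (auto intro!: mult_left_mono)
  finally have "(1 - m) * norm (w - u) \<le> m * norm (u - q)" by (simp add: algebra_simps)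
  then have "d * ((1 - m) * norm (w - u)) \<le> d * (m * norm (u - q))"
    using d \<open>a > 0\<close> by (intro mult_left_mono) auto
  moreover have "d * ((1 - m) * norm (w - u)) = ((1 - m) * d) * norm (w - u)" by simp
  moreover have "d * m = d - a" using m by (simp add: algebra_simps)
  ultimately have "a * norm (w - u) \<le> (d - a) * norm (u - q)"
    using m(3) by (metis mult.assoc)
  also have "\<dots> \<le> e * norm (u - q)"
    using gap by (intro mult_right_mono) (auto simp: d_def)
  also have "norm (u - q) \<le> c * (F u - Fmin) powr \<theta>"
    using eb u unfolding local_error_bound_def q_def by auto
  also have "\<dots> \<le> c * a powr \<theta>"
    using u assms min_value_le[of u] by (intro mult_left_mono powr_mono2) (auto simp: eps_sublevel_set_def)
  finally have "a * norm (w - u) \<le> e * (c * a powr \<theta>)" using \<open>e \<ge> 0\<close> by (simp add: mult_left_mono)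
  then have "norm (w - u) \<le> e * (c * a powr \<theta>) / a" using \<open>a > 0\<close> by (simp add: field_simps)
  also have "\<dots> = c * e * a powr (\<theta> - 1)" using \<open>a > 0\<close> by (simp add: powr_diff)
  finally show ?thesis unfolding u_def .
qed

lemma average_in_K:
  assumes "t \<ge> 1" "\<And>\<tau>. \<tau> \<in> {1..t} \<Longrightarrow> W \<tau> \<in> \<K>"
  shows "(1 / real t) *\<^sub>R (\<Sum>\<tau>=1..t. W \<tau>) \<in> \<K>"
proof -
  have "(\<Sum>\<tau>=1..t. (1 / real t) *\<^sub>R W \<tau>) \<in> \<K>"
    using assms K_convex by (intro convex_sum) auto
  then show ?thesis by (simp add: scaleR_sum_right)
qed

lemma F_average_le:
  assumes "t \<ge> 1" "\<And>\<tau>. \<tau> \<in> {1..t} \<Longrightarrow> W \<tau> \<in> \<K>"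
  shows "F ((1 / real t) *\<^sub>R (\<Sum>\<tau>=1..t. W \<tau>)) \<le> (\<Sum>\<tau>=1..t. F (W \<tau>)) / t"
proof -
  have "F (\<Sum>\<tau>=1..t. (1 / real t) *\<^sub>R W \<tau>) \<le> (\<Sum>\<tau>=1..t. (1 / real t) * F (W \<tau>))"
    using assms convex_on_F by (intro convex_on_sum) auto
  then show ?thesis by (simp add: scaleR_sum_right sum_divide_distrib)
qed

definition prox_obj :: "real \<Rightarrow> 'a \<Rightarrow> 'a \<Rightarrow> real" where
  "prox_obj l w v = F v + l / 2 * (norm (v - w))\<^sup>2"

definition prox :: "real \<Rightarrow> 'a \<Rightarrow> 'a" where
  "prox l w = (SOME p. p \<in> \<K> \<and> (\<forall>v\<in>\<K>. prox_obj l w p \<le> prox_obj l w v))"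

text \<open>
  Outside a large ball the quadratic term exceeds the gap of a fixed point of \<open>\<K>\<close>, since \<open>F\<close> is
  bounded below; inside, compactness gives a minimiser.
\<close>

lemma prox:
  assumes "l > 0"
  shows prox_in_K: "prox l w \<in> \<K>"
    and prox_le: "\<And>v. v \<in> \<K> \<Longrightarrow> prox_obj l w (prox l w) \<le> prox_obj l w v"
proof -
  obtain x where x: "x \<in> \<K>" using K_nonempty by auto
  define R where "R = norm (x - w) + (prox_obj l w x - Fmin) * 2 / l + 1"
  have px: "Fmin \<le> prox_obj l w x"
    using min_value_le[OF x] assms by (simp add: prox_obj_def add_increasing2)
  have R: "R \<ge> 1" "norm (x - w) \<le> R" "(prox_obj l w x - Fmin) * 2 / l \<le> R"
    using px assms by (auto simp: R_def)
  have "compact (\<K> \<inter> cball w R)" using K_closed by (simp add: closed_Int_compact)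
  moreover have "\<K> \<inter> cball w R \<noteq> {}" using x R by (auto simp: dist_norm norm_minus_commute)
  moreover have "continuous_on (\<K> \<inter> cball w R) (prox_obj l w)"
    unfolding prox_obj_def by (intro continuous_intros continuous_on_subset[OF continuous_on_F]) auto
  ultimately obtain p where p: "p \<in> \<K> \<inter> cball w R" "\<forall>v\<in>\<K> \<inter> cball w R. prox_obj l w p \<le> prox_obj l w v"
    using continuous_attains_inf by blast
  have "prox_obj l w p \<le> prox_obj l w v" if v: "v \<in> \<K>" for v
  proof (cases "v \<in> cball w R")
    case True then show ?thesis using p v by auto
  next
    case False
    then have "R < norm (v - w)" by (auto simp: dist_norm norm_minus_commute)
    then have "R \<le> (norm (v - w))\<^sup>2"
      using R self_le_power[of "norm (v - w)" 2] by linarith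
    then have "(prox_obj l w x - Fmin) * 2 / l \<le> (norm (v - w))\<^sup>2" using R by linarith
    then have "prox_obj l w x \<le> Fmin + l / 2 * (norm (v - w))\<^sup>2" using assms by (simp add: field_simps)
    also have "\<dots> \<le> prox_obj l w v" using min_value_le[OF v] by (simp add: prox_obj_def)
    finally have "prox_obj l w x \<le> prox_obj l w v" .
    moreover have "prox_obj l w p \<le> prox_obj l w x"
      using p x R by (auto simp: dist_norm norm_minus_commute)
    ultimately show ?thesis by simp
  qed
  then have "\<exists>p. p \<in> \<K> \<and> (\<forall>v\<in>\<K>. prox_obj l w p \<le> prox_obj l w v)" using p by auto
  from someI_ex[OF this] show "prox l w \<in> \<K>" "\<And>v. v \<in> \<K> \<Longrightarrow> prox_obj l w (prox l w) \<le> prox_obj l w v"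
    unfolding prox_def[symmetric] by auto
qed

lemma moreau_envelope_eq: "l > 0 \<Longrightarrow> moreau_envelope F \<K> l w = prox_obj l w (prox l w)"
  unfolding moreau_envelope_def
  using prox_in_K[of l w] prox_le[of l _ w]
  by (intro cInf_eq_minimum) (auto simp: prox_obj_def)

text \<open>
  Minimality of the proximal point \<open>p\<close> against \<open>(1 - s) p + s v\<close>, divided by \<open>s\<close>, in the limit
  \<open>s \<rightarrow> 0\<close>.
\<close>

lemma prox_obj_strongly_convex:
  assumes "l > 0" "v \<in> \<K>"
  shows "prox_obj l w (prox l w) + l / 2 * (norm (v - prox l w))\<^sup>2 \<le> prox_obj l w v"
proof -
  define p where "p = prox l w"
  have p: "p \<in> \<K>" using prox_in_K[OF assms(1)] by (simp add: p_def)
  define gap where "gap = prox_obj l w v - prox_obj l w p"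
  have "(1 - s) * (l / 2 * (norm (v - p))\<^sup>2) \<le> gap" if s: "0 < s" "s < 1" for s
  proof -
    define z where "z = (1 - s) *\<^sub>R p + s *\<^sub>R v"
    have zK: "z \<in> \<K>" unfolding z_def using K_convex p assms s by (auto intro!: convexD_alt)
    have n: "(norm (z - w))\<^sup>2 = (1 - s) * (norm (p - w))\<^sup>2 + s * (norm (v - w))\<^sup>2 - s * (1 - s) * (norm (v - p))\<^sup>2"
      unfolding power2_norm_eq_inner z_def
      by (simp add: inner_diff inner_add inner_commute algebra_simps)
    have "prox_obj l w p \<le> prox_obj l w z" using prox_le[OF assms(1) zK] by (simp add: p_def)
    also have "\<dots> \<le> ((1 - s) * F p + s * F v) + l / 2 * (norm (z - w))\<^sup>2"
      unfolding prox_obj_def z_def using convex_onD[OF convex_on_F, of s p v] s p assms by auto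
    also have "\<dots> = (1 - s) * prox_obj l w p + s * prox_obj l w v - s * ((1 - s) * (l / 2 * (norm (v - p))\<^sup>2))"
      unfolding n prox_obj_def by (simp add: field_simps)
    finally have "s * ((1 - s) * (l / 2 * (norm (v - p))\<^sup>2)) \<le> s * gap" by (simp add: gap_def algebra_simps)
    then show ?thesis using s by simp
  qed
  then have "\<forall>\<^sub>F s in at_right 0. (1 - s) * (l / 2 * (norm (v - p))\<^sup>2) \<le> gap"
    using eventually_at_right_real[of 0 "1::real"] by (auto elim: eventually_mono)
  moreover have "((\<lambda>s. (1 - s) * (l / 2 * (norm (v - p))\<^sup>2)) \<longlongrightarrow> (1 - 0) * (l / 2 * (norm (v - p))\<^sup>2)) (at_right 0)"
    by (intro tendsto_intros)
  ultimately have "(1 - 0) * (l / 2 * (norm (v - p))\<^sup>2) \<le> gap"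
    by (intro tendsto_upperbound) auto
  then show ?thesis by (simp add: gap_def p_def)
qed

lemma prox_nonexpansive:
  assumes "l > 0"
  shows "norm (prox l w - prox l w') \<le> norm (w - w')"
proof -
  define p where "p = prox l w"
  define p' where "p' = prox l w'"
  have "prox_obj l w p + l / 2 * (norm (p' - p))\<^sup>2 \<le> prox_obj l w p'"
    "prox_obj l w' p' + l / 2 * (norm (p - p'))\<^sup>2 \<le> prox_obj l w' p"
    unfolding p_def p'_def using prox_in_K[OF assms]
    by (auto simp del: times_divide_eq_left intro!: prox_obj_strongly_convex[OF assms])
  then have "l / 2 * ((norm (p - w))\<^sup>2 + (norm (p' - p))\<^sup>2 + (norm (p' - w'))\<^sup>2 + (norm (p - p'))\<^sup>2)
     \<le> l / 2 * ((norm (p' - w))\<^sup>2 + (norm (p - w'))\<^sup>2)"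
    by (simp add: prox_obj_def algebra_simps)
  then have "(norm (p - w))\<^sup>2 + (norm (p' - p))\<^sup>2 + (norm (p' - w'))\<^sup>2 + (norm (p - p'))\<^sup>2
     \<le> (norm (p' - w))\<^sup>2 + (norm (p - w'))\<^sup>2"
    using assms by simp
  then have "(norm (p - p'))\<^sup>2 \<le> (w - w') \<bullet> (p - p')"
    unfolding power2_norm_eq_inner by (simp add: inner_diff inner_commute)
  also have "\<dots> \<le> norm (w - w') * norm (p - p')" by (rule norm_cauchy_schwarz)
  finally have "norm (p - p') * norm (p - p') \<le> norm (w - w') * norm (p - p')" by (simp add: power2_eq_square)
  then show ?thesis unfolding p_def p'_def
    by (metis mult_right_le_imp_le norm_ge_zero norm_zero order_le_less)
qed

text \<open>
  Using the proximal point of \<open>x\<close> as a competitor at \<open>y\<close> bounds the envelope from above by a quadratic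
  with slope \<open>l (x - prox x)\<close> at \<open>x\<close>. Exchanging the roles of \<open>x\<close> and \<open>y\<close> gives a lower bound with the
  slope taken at \<open>y\<close>, and nonexpansiveness of the proximal map replaces it by the slope at \<open>x\<close>. The
  two bounds differ from the linearisation by at most \<open>l / 2 * (norm k)\<^sup>2\<close>.
\<close>

lemma GDERIV_moreau_envelope:
  assumes "l > 0"
  shows "GDERIV (moreau_envelope F \<K> l) w :> l *\<^sub>R (w - prox l w)"
proof -
  let ?e = "moreau_envelope F \<K> l"
  define p where "p = prox l w"
  have up: "?e y \<le> ?e x + l * ((x - prox l x) \<bullet> (y - x)) + l / 2 * (norm (y - x))\<^sup>2" for x y
  proof -
    have "?e y \<le> prox_obj l y (prox l x)"
      using prox_le[OF assms prox_in_K[OF assms]] moreau_envelope_eq[OF assms] by simp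
    also have "\<dots> = ?e x + l * ((x - prox l x) \<bullet> (y - x)) + l / 2 * (norm (y - x))\<^sup>2"
      unfolding moreau_envelope_eq[OF assms] prox_obj_def power2_norm_eq_inner
      by (simp add: inner_diff inner_commute algebra_simps)
    finally show ?thesis .
  qed
  have lo: "?e w + l * ((w - p) \<bullet> k) - l / 2 * (norm k)\<^sup>2 \<le> ?e (w + k)" for k
  proof -
    define p' where "p' = prox l (w + k)"
    have "?e w \<le> ?e (w + k) + l * ((w + k - p') \<bullet> (- k)) + l / 2 * (norm k)\<^sup>2"
      using up[of w "w + k"] by (simp add: p'_def)
    moreover have "l * ((p' - p) \<bullet> k) \<le> l * (norm k)\<^sup>2"
    proof -
      have "(p' - p) \<bullet> k \<le> norm (p' - p) * norm k" by (rule norm_cauchy_schwarz)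
      also have "\<dots> \<le> norm k * norm k"
        using prox_nonexpansive[OF assms, of "w + k" w] by (intro mult_right_mono) (auto simp: p'_def p_def)
      finally show ?thesis using assms by (simp add: power2_eq_square)
    qed
    ultimately show ?thesis
      by (simp add: inner_diff inner_add power2_norm_eq_inner algebra_simps)
  qed
  have bd: "norm (?e (w + k) - ?e w - k \<bullet> (l *\<^sub>R (w - p))) / norm k \<le> l / 2 * norm k" for k
  proof (cases "k = 0")
    case False
    have "\<bar>?e (w + k) - ?e w - k \<bullet> (l *\<^sub>R (w - p))\<bar> \<le> l / 2 * (norm k)\<^sup>2"
      using lo[of k] up[of "w + k" w] unfolding p_def inner_commute[of k] inner_scaleR_left abs_le_iff
      by (intro conjI; simp)
    then show ?thesis using False by (simp add: power2_eq_square field_simps)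
  qed simp
  have "((\<lambda>k. l / 2 * norm k) \<longlongrightarrow> l / 2 * norm (0::'a)) (at (0::'a))"
    by (intro tendsto_mult tendsto_const tendsto_norm tendsto_ident_at)
  then have "((\<lambda>k. l / 2 * norm k) \<longlongrightarrow> 0) (at (0::'a))" by simp
  then have "((\<lambda>k. norm (?e (w + k) - ?e w - k \<bullet> (l *\<^sub>R (w - p))) / norm k) \<longlongrightarrow> 0) (at 0)"
    by (rule Lim_null_comparison[rotated]) (use bd in \<open>auto intro!: always_eventually\<close>)
  then show ?thesis
    unfolding gderiv_def has_derivative_at p_def by (intro conjI bounded_linear_inner_left) simp
qed

text \<open>
  The set of good outcomes is stated by an existential quantifier over gradients; in this form it
  is a Borel condition on \<open>w\<close>, because the proximal map is continuous.
\<close>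

lemma moreau_gradient_small_iff:
  assumes "l > 0"
  shows "(\<exists>v. GDERIV (moreau_envelope F \<K> l) w :> v \<and> norm v \<le> \<epsilon>) \<longleftrightarrow> l * norm (w - prox l w) \<le> \<epsilon>"
proof -
  have "v = l *\<^sub>R (w - prox l w)" if "GDERIV (moreau_envelope F \<K> l) w :> v" for v
  proof -
    have "(\<lambda>k. k \<bullet> v) = (\<lambda>k. k \<bullet> (l *\<^sub>R (w - prox l w)))"
      using that GDERIV_moreau_envelope[OF assms] unfolding gderiv_def
      by (rule has_derivative_unique)
    then show ?thesis by (metis vector_eq_ldot)
  qed
  then have "(\<exists>v. GDERIV (moreau_envelope F \<K> l) w :> v \<and> norm v \<le> \<epsilon>)
      \<longleftrightarrow> norm (l *\<^sub>R (w - prox l w)) \<le> \<epsilon>"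
    using GDERIV_moreau_envelope[OF assms, of w] by metis
  then show ?thesis using assms by simp
qed

text \<open>
  The competitor \<open>w\<close> itself shows that the proximal point cannot be farther away than the gap of
  \<open>w\<close> pays for.
\<close>

lemma moreau_gradient_le:
  assumes "l > 0" "w \<in> \<K>"
  shows "(l * norm (w - prox l w))\<^sup>2 \<le> 2 * l * (F w - Fmin)"
proof -
  have "F (prox l w) + l / 2 * (norm (prox l w - w))\<^sup>2 \<le> F w"
    using prox_le[OF assms, of w] by (simp add: prox_obj_def)
  then have "l / 2 * (norm (w - prox l w))\<^sup>2 \<le> F w - Fmin"
    using min_value_le[OF prox_in_K[OF assms(1), of w]] by (simp add: norm_minus_commute)
  then have "(2 * l) * (l / 2 * (norm (w - prox l w))\<^sup>2) \<le> (2 * l) * (F w - Fmin)"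
    using assms by (intro mult_left_mono) auto
  then show ?thesis by (simp add: power2_eq_square algebra_simps)
qed

lemma continuous_on_prox: "l > 0 \<Longrightarrow> continuous_on UNIV (prox l)"
  using prox_nonexpansive
  by (intro lipschitz_on_continuous_on[of 1]) (auto simp: lipschitz_on_def dist_norm)

end

section \<open>Regret of subgradient steps\<close>

lemma projected_step:
  fixes C :: "'a::euclidean_space set"
  assumes "closed C" "convex C" "u \<in> C"
  shows "(norm (closest_point C (x - \<eta> *\<^sub>R v) - u))\<^sup>2
    \<le> (norm (x - u))\<^sup>2 - 2 * \<eta> * (v \<bullet> (x - u)) + \<eta>\<^sup>2 * (norm v)\<^sup>2"
proof -
  have "closest_point C u = u" using assms by (simp add: closest_point_self)
  then have "norm (closest_point C (x - \<eta> *\<^sub>R v) - u) \<le> norm ((x - u) - \<eta> *\<^sub>R v)"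
    using closest_point_lipschitz[OF assms(2,1), of "x - \<eta> *\<^sub>R v" u] assms(3)
    by (auto simp: dist_norm algebra_simps)
  then have "(norm (closest_point C (x - \<eta> *\<^sub>R v) - u))\<^sup>2 \<le> (norm ((x - u) - \<eta> *\<^sub>R v))\<^sup>2"
    by (rule power_mono) simp
  also have "\<dots> = (norm (x - u))\<^sup>2 - 2 * \<eta> * (v \<bullet> (x - u)) + \<eta>\<^sup>2 * (norm v)\<^sup>2"
    unfolding power2_norm_eq_inner
    by (simp add: inner_diff inner_commute power2_eq_square algebra_simps)
  finally show ?thesis .
qed

lemma inner_le_of_step:
  fixes b B q d d' \<eta> :: real
  assumes "d' \<le> d - 2 * \<eta> * b + \<eta>\<^sup>2 * q" "q \<le> B" "\<eta> > 0"
  shows "b \<le> (d - d') / (2 * \<eta>) + \<eta> / 2 * B"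
proof -
  have "\<eta>\<^sup>2 * q \<le> \<eta>\<^sup>2 * B" using assms by (intro mult_left_mono) auto
  then have "2 * \<eta> * b \<le> (d - d') + \<eta>\<^sup>2 * B" using assms by linarith
  then have "b \<le> ((d - d') + \<eta>\<^sup>2 * B) / (2 * \<eta>)" using \<open>\<eta> > 0\<close> by (simp add: field_simps)
  also have "\<dots> = (d - d') / (2 * \<eta>) + \<eta> / 2 * B"
    using \<open>\<eta> > 0\<close> by (simp add: field_simps power2_eq_square)
  finally show ?thesis .
qed

context bounded_subgradient
begin

lemma G_nonneg: "0 \<le> G"
  using lipschitz by (rule lipschitz_on_nonneg)

text \<open>
  The usual telescoping of squared distances. The average involves \<open>t\<close> iterates but a stage draws only
  \<open>t - 1\<close> samples. For the last iterate the mean subgradient \<open>h (W t)\<close> replaces the sampled one: of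
  the step along it only the nonnegativity of the squared distance afterwards is used. Hence the noise
  sum ends at \<open>t - 1\<close>.
\<close>

lemma projected_subgradient_regret:
  assumes C: "closed C" "convex C" "C \<subseteq> \<K>" "u \<in> C" and "\<eta> > 0" "1 \<le> t"
    and W: "\<And>\<tau>. 1 \<le> \<tau> \<Longrightarrow> \<tau> \<le> t \<Longrightarrow> W \<tau> \<in> C"
    and step: "\<And>\<tau>. 1 \<le> \<tau> \<Longrightarrow> \<tau> < t \<Longrightarrow> W (Suc \<tau>) = closest_point C (W \<tau> - \<eta> *\<^sub>R v \<tau>)"
    and v: "\<And>\<tau>. 1 \<le> \<tau> \<Longrightarrow> \<tau> < t \<Longrightarrow> norm (v \<tau>) \<le> G"
  shows "(\<Sum>\<tau>=1..t. F (W \<tau>) - F u) \<le> (norm (W 1 - u))\<^sup>2 / (2 * \<eta>) + real t * (\<eta> / 2 * G\<^sup>2)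
           + (\<Sum>\<tau>=1..<t. (h (W \<tau>) - v \<tau>) \<bullet> (W \<tau> - u))"
proof -
  let ?Z = "\<lambda>\<tau>. (h (W \<tau>) - v \<tau>) \<bullet> (W \<tau> - u)" and ?d = "\<lambda>\<tau>. (norm (W \<tau> - u))\<^sup>2"
  have uK: "u \<in> \<K>" using C by auto
  have K: "W \<tau> \<in> \<K>" if "1 \<le> \<tau>" "\<tau> \<le> t" for \<tau> using W[OF that] C by auto
  have one: "F (W \<tau>) - F u \<le> (?d \<tau> - ?d (Suc \<tau>)) / (2 * \<eta>) + \<eta> / 2 * G\<^sup>2 + ?Z \<tau>"
    if \<tau>: "1 \<le> \<tau>" "\<tau> < t" for \<tau>
  proof -
    have "v \<tau> \<bullet> (W \<tau> - u) \<le> (?d \<tau> - ?d (Suc \<tau>)) / (2 * \<eta>) + \<eta> / 2 * G\<^sup>2"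
      unfolding step[OF \<tau>]
      by (rule inner_le_of_step[OF projected_step[OF C(1,2,4)]])
        (use v[OF \<tau>] \<open>\<eta> > 0\<close> in \<open>auto intro: power_mono\<close>)
    then show ?thesis
      using subgradient_ineq[OF K uK, of \<tau>] \<tau> by (simp add: inner_diff_left)
  qed
  have "n \<le> t \<Longrightarrow> (\<Sum>\<tau>=1..<n. F (W \<tau>) - F u)
      \<le> (?d 1 - ?d n) / (2 * \<eta>) + (real n - 1) * (\<eta> / 2 * G\<^sup>2) + (\<Sum>\<tau>=1..<n. ?Z \<tau>)"
    if "1 \<le> n" for n
    using that
  proof (induction n rule: dec_induct)
    case (step m)
    then show ?case
      using one[of m] by (simp add: diff_divide_distrib algebra_simps)
  qed simp
  from this[OF \<open>1 \<le> t\<close> order_refl]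
  have "(\<Sum>\<tau>=1..<t. F (W \<tau>) - F u)
      \<le> (?d 1 - ?d t) / (2 * \<eta>) + (real t - 1) * (\<eta> / 2 * G\<^sup>2) + (\<Sum>\<tau>=1..<t. ?Z \<tau>)" .
  moreover have "F (W t) - F u \<le> (?d t - 0) / (2 * \<eta>) + \<eta> / 2 * G\<^sup>2"
  proof -
    have "0 \<le> (norm ((W t - u) - \<eta> *\<^sub>R h (W t)))\<^sup>2" by simp
    also have "\<dots> = ?d t - 2 * \<eta> * (h (W t) \<bullet> (W t - u)) + \<eta>\<^sup>2 * (norm (h (W t)))\<^sup>2"
      unfolding power2_norm_eq_inner
      by (simp add: inner_diff inner_commute power2_eq_square algebra_simps)
    finally have "h (W t) \<bullet> (W t - u) \<le> (?d t - 0) / (2 * \<eta>) + \<eta> / 2 * G\<^sup>2"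
      by (rule inner_le_of_step)
        (use norm_subgradient_le[of "W t"] K \<open>1 \<le> t\<close> \<open>\<eta> > 0\<close> in \<open>auto intro: power_mono\<close>)
    then show ?thesis using subgradient_ineq[OF K uK, of t] \<open>1 \<le> t\<close> by simp
  qed
  moreover have "(\<Sum>\<tau>=1..t. F (W \<tau>) - F u) = (\<Sum>\<tau>=1..<t. F (W \<tau>) - F u) + (F (W t) - F u)"
    using \<open>1 \<le> t\<close> by (subst sum.last_plus) (auto simp: atLeastLessThanSuc_atLeastAtMost[symmetric])
  ultimately show ?thesis by (simp add: diff_divide_distrib algebra_simps)
qed

lemma sum_inverse_le_ln:
  assumes "1 \<le> t"
  shows "(\<Sum>\<tau>=1..t. 1 / real \<tau>) \<le> 1 + ln (real t)"
  using euler_mascheroni_sequence_decreasing[of 1 t] assms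
  by (simp add: harm_def inverse_eq_divide)

text \<open>
  The update of ASSG-r is projected subgradient descent with step size \<open>2 \<beta> / \<tau>\<close> on the regularised
  objective \<open>F w + (norm (w - W 1))\<^sup>2 / (2 \<beta>)\<close>, whose stochastic subgradient is \<open>r (v \<tau>) (W \<tau>)\<close>. The
  iterates stay within \<open>2 \<beta> G\<close> of \<open>W 1\<close>, so these subgradients have norm at most \<open>3 G\<close> and the step
  size terms add up to \<open>9 \<beta> G\<^sup>2\<close> times a harmonic sum.
  
  Strong convexity contributes \<open>- (norm (W \<tau> - u))\<^sup>2 / (2 \<beta>)\<close> in every step. Summation by parts with
  the weights \<open>\<tau> / (4 \<beta>)\<close> uses up half of it; the other half is kept in the bound, where it absorbs
  the variance of the noise.
\<close>

lemma regularized_subgradient_regret: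
  assumes "u \<in> \<K>" "\<beta> > 0" "1 \<le> t"
    and W: "\<And>\<tau>. 1 \<le> \<tau> \<Longrightarrow> \<tau> \<le> t \<Longrightarrow> W \<tau> \<in> \<K>"
    and step: "\<And>\<tau>. 1 \<le> \<tau> \<Longrightarrow> \<tau> < t \<Longrightarrow> W (Suc \<tau>) = closest_point \<K>
       ((1 - 2 / real \<tau>) *\<^sub>R W \<tau> + (2 / real \<tau>) *\<^sub>R W 1 - (2 * \<beta> / real \<tau>) *\<^sub>R v \<tau>)"
    and v: "\<And>\<tau>. 1 \<le> \<tau> \<Longrightarrow> \<tau> < t \<Longrightarrow> norm (v \<tau>) \<le> G"
  shows "(\<Sum>\<tau>=1..t. F (W \<tau>) - F u) \<le> real t * ((norm (u - W 1))\<^sup>2 / (2 * \<beta>))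
           + 9 * \<beta> * G\<^sup>2 * (1 + ln (real t)) - (\<Sum>\<tau>=1..<t. (norm (W \<tau> - u))\<^sup>2) / (4 * \<beta>)
           + (\<Sum>\<tau>=1..<t. (h (W \<tau>) - v \<tau>) \<bullet> (W \<tau> - u))"
proof -
  let ?Z = "\<lambda>\<tau>. (h (W \<tau>) - v \<tau>) \<bullet> (W \<tau> - u)" and ?d = "\<lambda>\<tau>. (norm (W \<tau> - u))\<^sup>2"
  let ?B = "(norm (u - W 1))\<^sup>2 / (2 * \<beta>)"
  define r where "r x y = x + (1 / \<beta>) *\<^sub>R (y - W 1)" for x y
  have step': "W (Suc \<tau>) = closest_point \<K> (W \<tau> - (2 * \<beta> / real \<tau>) *\<^sub>R r (v \<tau>) (W \<tau>))"
    if \<tau>: "1 \<le> \<tau>" "\<tau> < t" for \<tau>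
    using step[OF \<tau>] \<open>\<beta> > 0\<close> by (simp add: r_def algebra_simps)
  have W1: "norm (W \<tau> - W 1) \<le> 2 * \<beta> * G" if "1 \<le> \<tau>" "\<tau> \<le> t" for \<tau>
    using that
  proof (induction \<tau> rule: dec_induct)
    case base
    then show ?case using G_nonneg \<open>\<beta> > 0\<close> by simp
  next
    case (step m)
    let ?b = "2 / real m"
    have b: "?b > 0" using step by simp
    have "norm (W (Suc m) - W 1) \<le> norm (((1 - ?b) *\<^sub>R W m + ?b *\<^sub>R W 1 - (2 * \<beta> / real m) *\<^sub>R v m) - W 1)"
      using closest_point_lipschitz[OF K_convex K_closed K_nonempty, of _ "W 1"]
        W[of 1] \<open>1 \<le> t\<close> closest_point_self[of "W 1" \<K>] assms(5)[of m] step
      by (simp add: dist_norm)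
    also have "((1 - ?b) *\<^sub>R W m + ?b *\<^sub>R W 1 - (2 * \<beta> / real m) *\<^sub>R v m) - W 1
        = (1 - ?b) *\<^sub>R (W m - W 1) - (?b * \<beta>) *\<^sub>R v m"
      by (simp add: algebra_simps)
    also have "norm \<dots> \<le> \<bar>1 - ?b\<bar> * norm (W m - W 1) + ?b * \<beta> * norm (v m)"
      using norm_triangle_ineq4[of "(1 - ?b) *\<^sub>R (W m - W 1)" "(?b * \<beta>) *\<^sub>R v m"] b \<open>\<beta> > 0\<close>
      by simp
    also have "\<dots> \<le> \<bar>1 - ?b\<bar> * norm (W m - W 1) + ?b * \<beta> * G"
      using v[of m] step b \<open>\<beta> > 0\<close> by (intro add_left_mono mult_left_mono) auto
    also have "\<dots> \<le> 2 * \<beta> * G"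
    proof (cases "m = 1")
      case True
      then show ?thesis by simp
    next
      case False
      then have b1: "?b \<le> 1" using step by simp
      then have "\<bar>1 - ?b\<bar> * norm (W m - W 1) \<le> (1 - ?b) * (2 * \<beta> * G)"
        using step by (simp add: mult_left_mono)
      then have "\<bar>1 - ?b\<bar> * norm (W m - W 1) + ?b * \<beta> * G \<le> 2 * \<beta> * G - ?b * \<beta> * G"
        by (simp add: algebra_simps)
      moreover have "0 \<le> ?b * \<beta> * G" using b \<open>\<beta> > 0\<close> G_nonneg by simp
      ultimately show ?thesis by linarith
    qed
    finally show ?case .
  qed
  have r: "(norm (r x (W \<tau>)))\<^sup>2 \<le> 9 * G\<^sup>2" if "1 \<le> \<tau>" "\<tau> \<le> t" "norm x \<le> G" for x \<tau>
  proof -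
    have "norm (r x (W \<tau>)) \<le> norm x + norm (W \<tau> - W 1) / \<beta>"
      using norm_triangle_ineq[of x "(1 / \<beta>) *\<^sub>R (W \<tau> - W 1)"] \<open>\<beta> > 0\<close> by (simp add: r_def)
    also have "\<dots> \<le> G + 2 * \<beta> * G / \<beta>"
      using W1[OF that(1,2)] that(3) \<open>\<beta> > 0\<close> by (intro add_mono divide_right_mono) auto
    finally have "norm (r x (W \<tau>)) \<le> 3 * G" using \<open>\<beta> > 0\<close> by simp
    then have "(norm (r x (W \<tau>)))\<^sup>2 \<le> (3 * G)\<^sup>2" by (rule power_mono) simp
    then show ?thesis by (simp add: power2_eq_square)
  qed
  \<comment> \<open>Strong convexity of the regularised objective; its value at \<open>W \<tau>\<close> is bounded below by \<open>F (W \<tau>)\<close>.\<close>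
  have reg: "F (W \<tau>) - F u \<le> ?B + r (h (W \<tau>)) (W \<tau>) \<bullet> (W \<tau> - u) - ?d \<tau> / (2 * \<beta>)"
    if \<tau>: "1 \<le> \<tau>" "\<tau> \<le> t" for \<tau>
  proof -
    have id: "(norm (W \<tau> - W 1))\<^sup>2 - (norm (u - W 1))\<^sup>2 = 2 * ((W \<tau> - W 1) \<bullet> (W \<tau> - u)) - ?d \<tau>"
      unfolding power2_norm_eq_inner by (simp add: inner_diff inner_commute algebra_simps)
    have "F (W \<tau>) - F u \<le> h (W \<tau>) \<bullet> (W \<tau> - u) + (norm (W \<tau> - W 1))\<^sup>2 / (2 * \<beta>)"
      using subgradient_ineq[OF W[OF \<tau>] \<open>u \<in> \<K>\<close>] \<open>\<beta> > 0\<close> by (simp add: add_increasing2)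
    also have "(norm (W \<tau> - W 1))\<^sup>2 = (norm (u - W 1))\<^sup>2 + 2 * ((W \<tau> - W 1) \<bullet> (W \<tau> - u)) - ?d \<tau>"
      using id by simp
    also have "h (W \<tau>) \<bullet> (W \<tau> - u) + \<dots> / (2 * \<beta>)
        = ?B + r (h (W \<tau>)) (W \<tau>) \<bullet> (W \<tau> - u) - ?d \<tau> / (2 * \<beta>)"
      using \<open>\<beta> > 0\<close> by (simp add: r_def inner_add_left add_divide_distrib diff_divide_distrib)
    finally show ?thesis .
  qed
  have one: "F (W \<tau>) - F u \<le> ?B + ?Z \<tau> + real \<tau> / (4 * \<beta>) * (?d \<tau> - ?d (Suc \<tau>))
      + 9 * \<beta> * G\<^sup>2 * (1 / real \<tau>) - ?d \<tau> / (2 * \<beta>)"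
    if \<tau>: "1 \<le> \<tau>" "\<tau> < t" for \<tau>
  proof -
    let ?\<eta> = "2 * \<beta> / real \<tau>"
    have "r (v \<tau>) (W \<tau>) \<bullet> (W \<tau> - u) \<le> (?d \<tau> - ?d (Suc \<tau>)) / (2 * ?\<eta>) + ?\<eta> / 2 * (9 * G\<^sup>2)"
      unfolding step'[OF \<tau>]
      by (rule inner_le_of_step[OF projected_step[OF K_closed K_convex \<open>u \<in> \<K>\<close>]])
        (use r[of \<tau> "v \<tau>"] v[OF \<tau>] \<tau> \<open>\<beta> > 0\<close> in auto)
    also have "\<dots> = real \<tau> / (4 * \<beta>) * (?d \<tau> - ?d (Suc \<tau>)) + 9 * \<beta> * G\<^sup>2 * (1 / real \<tau>)"
      using \<tau> \<open>\<beta> > 0\<close> by (simp add: field_simps)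
    finally have "r (v \<tau>) (W \<tau>) \<bullet> (W \<tau> - u)
      \<le> real \<tau> / (4 * \<beta>) * (?d \<tau> - ?d (Suc \<tau>)) + 9 * \<beta> * G\<^sup>2 * (1 / real \<tau>)" .
    moreover have "r (h (W \<tau>)) (W \<tau>) \<bullet> (W \<tau> - u) = ?Z \<tau> + r (v \<tau>) (W \<tau>) \<bullet> (W \<tau> - u)"
      by (simp add: r_def inner_add_left inner_diff_left)
    ultimately show ?thesis using reg[of \<tau>] \<tau> by linarith
  qed
  have "n \<le> t \<Longrightarrow> (\<Sum>\<tau>=1..<n. F (W \<tau>) - F u) \<le> (real n - 1) * ?B + (\<Sum>\<tau>=1..<n. ?Z \<tau>)
      + 9 * \<beta> * G\<^sup>2 * (\<Sum>\<tau>=1..<n. 1 / real \<tau>) - (\<Sum>\<tau>=1..<n. ?d \<tau>) / (4 * \<beta>)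
      - (real n - 1) / (4 * \<beta>) * ?d n"
    if "1 \<le> n" for n
    using that
  proof (induction n rule: dec_induct)
    case (step m)
    define q where "q = 1 / (4 * \<beta>)"
    have q: "x / (4 * \<beta>) = q * x" "x / (2 * \<beta>) = 2 * (q * x)" for x by (auto simp: q_def)
    show ?case
      using one[of m] step unfolding q by (simp add: algebra_simps)
  qed simp
  from this[OF \<open>1 \<le> t\<close> order_refl]
  have A: "(\<Sum>\<tau>=1..<t. F (W \<tau>) - F u) \<le> (real t - 1) * ?B + (\<Sum>\<tau>=1..<t. ?Z \<tau>)
      + 9 * \<beta> * G\<^sup>2 * (\<Sum>\<tau>=1..<t. 1 / real \<tau>) - (\<Sum>\<tau>=1..<t. ?d \<tau>) / (4 * \<beta>)
      - (real t - 1) / (4 * \<beta>) * ?d t" .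
  have last: "sum f {1..t} = sum f {1..<t} + f t" for f :: "nat \<Rightarrow> real"
    using \<open>1 \<le> t\<close> by (subst sum.last_plus) (auto simp: atLeastLessThanSuc_atLeastAtMost[symmetric])
  \<comment> \<open>The last iterate, again without a sample: a mean step whose squared distance is nonnegative.\<close>
  have "F (W t) - F u \<le> ?B + real t / (4 * \<beta>) * ?d t + 9 * \<beta> * G\<^sup>2 * (1 / real t) - ?d t / (2 * \<beta>)"
  proof -
    let ?\<eta> = "2 * \<beta> / real t" and ?r = "r (h (W t)) (W t)"
    have "0 \<le> (norm ((W t - u) - ?\<eta> *\<^sub>R ?r))\<^sup>2" by simp
    also have "\<dots> = ?d t - 2 * ?\<eta> * (?r \<bullet> (W t - u)) + ?\<eta>\<^sup>2 * (norm ?r)\<^sup>2"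
      unfolding power2_norm_eq_inner
      by (simp add: inner_diff inner_commute power2_eq_square algebra_simps)
    finally have "?r \<bullet> (W t - u) \<le> (?d t - 0) / (2 * ?\<eta>) + ?\<eta> / 2 * (9 * G\<^sup>2)"
      by (rule inner_le_of_step)
        (use r[of t "h (W t)"] norm_subgradient_le[OF W, of t] \<open>1 \<le> t\<close> \<open>\<beta> > 0\<close> in auto)
    also have "\<dots> = real t / (4 * \<beta>) * ?d t + 9 * \<beta> * G\<^sup>2 * (1 / real t)"
      using \<open>1 \<le> t\<close> \<open>\<beta> > 0\<close> by (simp add: field_simps)
    finally show ?thesis using reg[of t] \<open>1 \<le> t\<close> by linarith
  qed
  moreover have "?d t / (2 * \<beta>) + (real t - 1) / (4 * \<beta>) * ?d t - real t / (4 * \<beta>) * ?d t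
      = ?d t / (4 * \<beta>)" using \<open>\<beta> > 0\<close> by (simp add: field_simps)
  moreover have "0 \<le> ?d t / (4 * \<beta>)" using \<open>\<beta> > 0\<close> by simp
  moreover have "9 * \<beta> * G\<^sup>2 * (\<Sum>\<tau>=1..<t. 1 / real \<tau>) + 9 * \<beta> * G\<^sup>2 * (1 / real t)
      \<le> 9 * \<beta> * G\<^sup>2 * (1 + ln (real t))"
    unfolding distrib_left[symmetric]
    using sum_inverse_le_ln[OF \<open>1 \<le> t\<close>] \<open>\<beta> > 0\<close> last[of "\<lambda>\<tau>. 1 / real \<tau>"]
    by (intro mult_left_mono) simp_all
  moreover have "(real t - 1) * ?B + ?B = real t * ?B" by (simp only: left_diff_distrib)
  ultimately show ?thesis using A last[of "\<lambda>\<tau>. F (W \<tau>) - F u"] by linarith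
qed

end

section \<open>Exponential supermartingales from independent samples\<close>

text \<open>
  The \<open>\<sigma>\<close>-algebra of the samples with index in \<open>J\<close>. Adaptedness of the iterates becomes measurability
  with respect to it, which composes like any other measurability statement; no explicit
  representation of an iterate as a function of the samples is needed.
\<close>

definition generated_algebra :: "'w measure \<Rightarrow> 's measure \<Rightarrow> ('i \<Rightarrow> 'w \<Rightarrow> 's) \<Rightarrow> 'i set \<Rightarrow> 'w measure" where
  "generated_algebra M D X J = vimage_algebra (space M) (\<lambda>\<omega>. \<lambda>i\<in>J. X i \<omega>) (PiM J (\<lambda>_. D))"

lemma space_generated_algebra [simp]: "space (generated_algebra M D X J) = space M"
  by (simp add: generated_algebra_def)

lemma measurable_generated_algebra:
  assumes "\<And>i. i \<in> J \<Longrightarrow> X i \<in> measurable M D" "i \<in> J"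
  shows "X i \<in> measurable (generated_algebra M D X J) D"
proof -
  have "(\<lambda>\<omega>. \<lambda>i\<in>J. X i \<omega>) \<in> measurable (generated_algebra M D X J) (PiM J (\<lambda>_. D))"
    unfolding generated_algebra_def
    by (rule measurable_vimage_algebra1) (use measurable_space[OF assms(1)] in \<open>auto simp: space_PiM\<close>)
  from measurable_compose[OF this measurable_component_singleton[OF assms(2)]] show ?thesis
    using assms(2) by simp
qed

lemma measurable_generated_algebra_mono:
  assumes X: "\<And>i. i \<in> J' \<Longrightarrow> X i \<in> measurable M D" and "J \<subseteq> J'"
    and Y: "Y \<in> measurable (generated_algebra M D X J) N"
  shows "Y \<in> measurable (generated_algebra M D X J') N"
proof -
  have "(\<lambda>\<omega>. \<omega>) \<in> measurable (generated_algebra M D X J') (generated_algebra M D X J)"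
    unfolding generated_algebra_def[of M D X J] using assms
    by (intro measurable_vimage_algebra2 measurable_restrict measurable_generated_algebra) auto
  from measurable_compose[OF this Y] show ?thesis .
qed

lemma measurable_from_generated_algebra:
  assumes X: "\<And>i. i \<in> J \<Longrightarrow> X i \<in> measurable M D"
    and Y: "Y \<in> measurable (generated_algebra M D X J) N"
  shows "Y \<in> measurable M N"
proof -
  have "(\<lambda>\<omega>. \<omega>) \<in> measurable M (generated_algebra M D X J)"
    unfolding generated_algebra_def[of M D X J] using assms
    by (intro measurable_vimage_algebra2 measurable_restrict) auto
  from measurable_compose[OF this Y] show ?thesis .
qed

text \<open>
  A fresh sample is independent of everything computed from earlier ones. Independence is expressed by
  a product of distributions, the form in which Fubini applies.
\<close>

lemma (in prob_space) distr_pair_generated_algebra: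
  assumes iid: "iid_copies M D X I" and J: "J \<subseteq> I" "i \<in> I" "i \<notin> J"
    and Y: "Y \<in> measurable (generated_algebra M D X J) N"
  shows "distr M N Y \<Otimes>\<^sub>M D = distr M (N \<Otimes>\<^sub>M D) (\<lambda>\<omega>. (Y \<omega>, X i \<omega>))"
proof -
  let ?R = "\<lambda>\<omega>. \<lambda>j\<in>J. X j \<omega>" and ?S = "\<lambda>\<omega>. \<lambda>j\<in>{i}. X j \<omega>"
  let ?P = "PiM J (\<lambda>_. D)" and ?Q = "PiM {i} (\<lambda>_. D)"
  have ind: "indep_vars (\<lambda>_. D) X I" and distr: "distr M D (X i) = D"
    using iid J by (auto simp: iid_copies_def)
  have X: "X j \<in> measurable M D" if "j \<in> I" for j using ind that by (auto simp: indep_vars_def)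
  note X[OF J(2), measurable]
  have YM[measurable]: "Y \<in> measurable M N"
    by (rule measurable_from_generated_algebra[OF _ Y]) (use J X in auto)
  have "indep_var ?P ?R ?Q ?S"
    using J by (intro indep_var_restrict[OF ind]) auto
  then have 1: "indep_set (sigma_sets (space M) {?R -` A \<inter> space M | A. A \<in> sets ?P})
      (sigma_sets (space M) {?S -` A \<inter> space M | A. A \<in> sets ?Q})"
    by (simp add: indep_var_eq)
  have ev: "prob ((Y -` A \<inter> space M) \<inter> (X i -` B \<inter> space M))
      = prob (Y -` A \<inter> space M) * prob (X i -` B \<inter> space M)"
    if A: "A \<in> sets N" and B: "B \<in> sets D" for A B
  proof (rule indep_setD[OF 1])
    show "Y -` A \<inter> space M \<in> sigma_sets (space M) {?R -` A \<inter> space M | A. A \<in> sets ?P}"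
      using measurable_sets[OF Y A] by (simp add: generated_algebra_def sets_vimage_algebra)
    have "(\<lambda>x. x i) -` B \<inter> space ?Q \<in> sets ?Q"
      using B by (intro measurable_sets[OF measurable_component_singleton]) auto
    moreover have "X i -` B \<inter> space M = ?S -` ((\<lambda>x. x i) -` B \<inter> space ?Q) \<inter> space M"
      using measurable_space[OF X[OF J(2)]] by (auto simp: space_PiM)
    ultimately show "X i -` B \<inter> space M \<in> sigma_sets (space M) {?S -` A \<inter> space M | A. A \<in> sets ?Q}"
      by blast
  qed
  interpret DY: prob_space "distr M N Y" by (rule prob_space_distr) measurable
  interpret D: prob_space D
    by (subst distr[symmetric], rule prob_space_distr) measurable
  show ?thesis
  proof (rule pair_measure_eqI)
    fix A B assume "A \<in> sets (distr M N Y)" and B: "B \<in> sets D"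
    then have A: "A \<in> sets N" by simp
    have "emeasure (distr M N Y) A * emeasure D B
        = emeasure M (Y -` A \<inter> space M) * emeasure M (X i -` B \<inter> space M)"
    proof -
      have "emeasure D B = emeasure (distr M D (X i)) B" by (simp add: distr)
      then show ?thesis using A B by (simp add: emeasure_distr)
    qed
    also have "\<dots> = emeasure M ((Y -` A \<inter> space M) \<inter> (X i -` B \<inter> space M))"
      unfolding emeasure_eq_measure ev[OF A B] by (simp add: ennreal_mult'')
    also have "(Y -` A \<inter> space M) \<inter> (X i -` B \<inter> space M)
        = (\<lambda>\<omega>. (Y \<omega>, X i \<omega>)) -` (A \<times> B) \<inter> space M" by auto
    also have "emeasure M \<dots> = emeasure (distr M (N \<Otimes>\<^sub>M D) (\<lambda>\<omega>. (Y \<omega>, X i \<omega>))) (A \<times> B)"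
      using A B by (subst emeasure_distr) auto
    finally show "emeasure (distr M N Y) A * emeasure D B
        = emeasure (distr M (N \<Otimes>\<^sub>M D) (\<lambda>\<omega>. (Y \<omega>, X i \<omega>))) (A \<times> B)" .
  qed (auto intro!: DY.sigma_finite_measure_axioms D.sigma_finite_measure_axioms)
qed

text \<open>
  The partial sum is carried along as part of the state, so one step integrates out the fresh sample
  \<open>X m\<close> first, for a fixed state, and this can only decrease the exponential moment.
\<close>

lemma (in prob_space) exponential_supermartingale:
  fixes \<phi> :: "'y \<times> 's \<Rightarrow> real" and n :: nat
  assumes \<phi>[measurable]: "\<phi> \<in> borel_measurable (N \<Otimes>\<^sub>M D)" and A[measurable]: "A \<in> sets N"
    and D: "prob_space D"
    and X: "\<And>m. 1 \<le> m \<Longrightarrow> m < n \<Longrightarrow> X m \<in> measurable M D"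
    and meas: "\<And>m. 1 \<le> m \<Longrightarrow> m < n \<Longrightarrow> Y m \<in> measurable M N"
    and joint: "\<And>m. 1 \<le> m \<Longrightarrow> m < n \<Longrightarrow>
       distr M (N \<Otimes>\<^sub>M borel) (\<lambda>\<omega>. (Y m \<omega>, \<Sum>j=1..<m. \<phi> (Y j \<omega>, X j \<omega>))) \<Otimes>\<^sub>M D
       = distr M ((N \<Otimes>\<^sub>M borel) \<Otimes>\<^sub>M D)
           (\<lambda>\<omega>. ((Y m \<omega>, \<Sum>j=1..<m. \<phi> (Y j \<omega>, X j \<omega>)), X m \<omega>))"
    and Y: "\<And>m \<omega>. 1 \<le> m \<Longrightarrow> m < n \<Longrightarrow> \<omega> \<in> space M \<Longrightarrow> Y m \<omega> \<in> A"
    and le: "\<And>y. y \<in> A \<Longrightarrow> (\<integral>\<^sup>+x. exp (\<phi> (y, x)) \<partial>D) \<le> 1"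
    and "1 \<le> n"
  shows "(\<integral>\<^sup>+\<omega>. exp (\<Sum>j=1..<n. \<phi> (Y j \<omega>, X j \<omega>)) \<partial>M) \<le> 1"
proof -
  interpret D: prob_space D by fact
  have "m \<le> n \<Longrightarrow> (\<integral>\<^sup>+\<omega>. exp (\<Sum>j=1..<m. \<phi> (Y j \<omega>, X j \<omega>)) \<partial>M) \<le> 1" if "1 \<le> m" for m
    using that
  proof (induction m rule: dec_induct)
    case base
    then show ?case by (simp add: emeasure_space_1)
  next
    case (step m)
    then have m: "1 \<le> m" "m < n" by auto
    define S where "S = (\<lambda>\<omega>. \<Sum>j=1..<m. \<phi> (Y j \<omega>, X j \<omega>))"
    let ?Q = "distr M (N \<Otimes>\<^sub>M borel) (\<lambda>\<omega>. (Y m \<omega>, S \<omega>))"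
    have S[measurable]: "S \<in> borel_measurable M"
      unfolding S_def using X meas m
      by (intro borel_measurable_sum measurable_compose[OF measurable_Pair \<phi>]) auto
    note X[OF m, measurable] meas[OF m, measurable]
    have joint': "?Q \<Otimes>\<^sub>M D = distr M ((N \<Otimes>\<^sub>M borel) \<Otimes>\<^sub>M D) (\<lambda>\<omega>. ((Y m \<omega>, S \<omega>), X m \<omega>))"
      using joint[OF m] by (simp add: S_def)
    have "(\<integral>\<^sup>+\<omega>. exp (\<Sum>j=1..<Suc m. \<phi> (Y j \<omega>, X j \<omega>)) \<partial>M)
        = (\<integral>\<^sup>+\<omega>. exp (S \<omega>) * exp (\<phi> (Y m \<omega>, X m \<omega>)) \<partial>M)"
      using m by (simp add: S_def exp_add)
    also have "\<dots> = (\<integral>\<^sup>+((y, s), x). exp s * exp (\<phi> (y, x))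
        \<partial>distr M ((N \<Otimes>\<^sub>M borel) \<Otimes>\<^sub>M D) (\<lambda>\<omega>. ((Y m \<omega>, S \<omega>), X m \<omega>)))"
      by (subst nn_integral_distr) (auto simp: case_prod_beta)
    also have "\<dots> = (\<integral>\<^sup>+z. (\<integral>\<^sup>+x. exp (snd z) * exp (\<phi> (fst z, x)) \<partial>D) \<partial>?Q)"
      unfolding joint'[symmetric]
      by (subst D.nn_integral_fst[symmetric]) (auto simp: case_prod_beta)
    also have "\<dots> \<le> (\<integral>\<^sup>+z. exp (snd z) \<partial>?Q)"
    proof (rule nn_integral_mono_AE)
      have "AE z in ?Q. fst z \<in> A"
        by (subst AE_distr_iff) (use Y[OF m] in auto)
      moreover have "AE z in ?Q. z \<in> space (N \<Otimes>\<^sub>M borel)" by (rule AE_I2) simp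
      ultimately show "AE z in ?Q. (\<integral>\<^sup>+x. exp (snd z) * exp (\<phi> (fst z, x)) \<partial>D) \<le> ennreal (exp (snd z))"
      proof eventually_elim
        case (elim z)
        then have [measurable]: "fst z \<in> space N" by (auto simp: space_pair_measure)
        have "(\<integral>\<^sup>+x. exp (snd z) * exp (\<phi> (fst z, x)) \<partial>D)
            = ennreal (exp (snd z)) * (\<integral>\<^sup>+x. exp (\<phi> (fst z, x)) \<partial>D)"
          by (subst nn_integral_cmult[symmetric]) (auto simp: ennreal_mult')
        also have "\<dots> \<le> ennreal (exp (snd z)) * 1"
          using le[OF elim(1)] by (rule mult_left_mono) simp
        finally show ?case by simp
      qed
    qed
    also have "\<dots> = (\<integral>\<^sup>+\<omega>. exp (S \<omega>) \<partial>M)" by (subst nn_integral_distr) auto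
    also have "\<dots> \<le> 1" using step by (simp add: S_def)
    finally show ?case .
  qed
  then show ?thesis using \<open>1 \<le> n\<close> by simp
qed

text \<open>
  Given the iterate, \<open>g x \<bullet> d\<close> ranges over an interval of length \<open>2 G (norm d)\<close>; this is Hoeffding's lemma
  with the compensator moved to the left.
\<close>

lemma (in prob_space) hoeffding_inner_product:
  fixes g :: "'a \<Rightarrow> 'b::euclidean_space"
  assumes g[measurable]: "g \<in> borel_measurable M" and bd: "\<And>x. x \<in> space M \<Longrightarrow> norm (g x) \<le> G" and "s > 0"
  defines "m \<equiv> \<integral>x. g x \<partial>M"
  shows "(\<integral>\<^sup>+x. exp (s * ((m - g x) \<bullet> d) - s\<^sup>2 * G\<^sup>2 / 2 * (norm d)\<^sup>2) \<partial>M) \<le> 1"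
proof -
  have int: "integrable M g"
    by (rule integrable_const_bound[of _ G]) (use bd in auto)
  let ?f = "\<lambda>x. (m - g x) \<bullet> d"
  let ?c = "s\<^sup>2 * G\<^sup>2 / 2 * (norm d)\<^sup>2"
  interpret f: interval_bounded_random_variable M ?f "m \<bullet> d - G * norm d" "m \<bullet> d + G * norm d"
  proof unfold_locales
    have "\<bar>g x \<bullet> d\<bar> \<le> G * norm d" if "x \<in> space M" for x
      using Cauchy_Schwarz_ineq2[of "g x" d] mult_right_mono[OF bd[OF that], of "norm d"] by simp
    then show "AE x in M. ?f x \<in> {m \<bullet> d - G * norm d .. m \<bullet> d + G * norm d}"
      by (intro AE_I2) (fastforce simp: inner_diff abs_le_iff)
  qed simp
  have "expectation ?f = (m - m) \<bullet> d"
    using int by (simp add: inner_diff prob_space m_def)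
  then have "(\<integral>\<^sup>+x. exp (s * ?f x) \<partial>M)
      \<le> ennreal (exp (s\<^sup>2 * ((m \<bullet> d + G * norm d) - (m \<bullet> d - G * norm d))\<^sup>2 / 8))"
    using \<open>s > 0\<close> by (intro f.Hoeffdings_lemma_nn_integral_0) auto
  also have "s\<^sup>2 * ((m \<bullet> d + G * norm d) - (m \<bullet> d - G * norm d))\<^sup>2 / 8 = ?c"
    by (simp add: power2_eq_square algebra_simps)
  finally have *: "(\<integral>\<^sup>+x. exp (s * ?f x) \<partial>M) \<le> ennreal (exp ?c)" .
  have "(\<integral>\<^sup>+x. exp (s * ?f x - ?c) \<partial>M) = (\<integral>\<^sup>+x. ennreal (exp (- ?c)) * exp (s * ?f x) \<partial>M)"
    by (simp flip: ennreal_mult' exp_add)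
  also have "\<dots> = ennreal (exp (- ?c)) * (\<integral>\<^sup>+x. exp (s * ?f x) \<partial>M)"
    by (rule nn_integral_cmult) simp
  also have "\<dots> \<le> ennreal (exp (- ?c)) * ennreal (exp ?c)"
    using * by (rule mult_left_mono) simp
  also have "\<dots> = 1" by (simp flip: ennreal_mult' exp_add)
  finally show ?thesis .
qed

lemma (in prob_space) prob_ge_ln_le:
  assumes [measurable]: "S \<in> borel_measurable M" and le: "(\<integral>\<^sup>+\<omega>. exp (S \<omega>) \<partial>M) \<le> 1" and "p > 0"
  shows "prob {\<omega> \<in> space M. ln (1 / p) \<le> S \<omega>} \<le> p"
proof -
  have "emeasure M {\<omega> \<in> space M. ln (1 / p) \<le> S \<omega>}
      \<le> emeasure M {\<omega> \<in> space M. 1 \<le> ennreal p * ennreal (exp (S \<omega>))}"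
  proof (rule emeasure_mono)
    have "1 \<le> p * exp (S \<omega>)" if "ln (1 / p) \<le> S \<omega>" for \<omega>
    proof -
      have "1 / p \<le> exp (S \<omega>)" using that \<open>p > 0\<close> by (metis exp_le_cancel_iff exp_ln zero_less_divide_1_iff)
      then show ?thesis using \<open>p > 0\<close> by (simp add: field_simps)
    qed
    then show "{\<omega> \<in> space M. ln (1 / p) \<le> S \<omega>} \<subseteq> {\<omega> \<in> space M. 1 \<le> ennreal p * ennreal (exp (S \<omega>))}"
      using \<open>p > 0\<close> by (auto simp flip: ennreal_mult' ennreal_1 simp del: ennreal_1)
  qed measurable
  also have "\<dots> \<le> ennreal p * (\<integral>\<^sup>+\<omega>. ennreal (exp (S \<omega>)) * indicator (space M) \<omega> \<partial>M)"
    by (rule nn_integral_Markov_inequality) auto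
  also have "(\<integral>\<^sup>+\<omega>. ennreal (exp (S \<omega>)) * indicator (space M) \<omega> \<partial>M) = (\<integral>\<^sup>+\<omega>. exp (S \<omega>) \<partial>M)"
    by (intro nn_integral_cong) auto
  also have "ennreal p * \<dots> \<le> ennreal p * 1" using le by (rule mult_left_mono) simp
  finally show ?thesis using \<open>p > 0\<close> by (simp add: emeasure_eq_measure)
qed

section \<open>Noise of the stochastic subgradients\<close>

text \<open>
  The defining equations branch on \<open>\<tau> = 0\<close> only to skip the dummy iterate; the following forms start
  at iterate 1.
\<close>

lemma assg_c_iterate_simps:
  "assg_c_iterate g C \<eta> z w1 (Suc 0) = w1"
  "1 \<le> \<tau> \<Longrightarrow> assg_c_iterate g C \<eta> z w1 (Suc \<tau>) = closest_point C
     (assg_c_iterate g C \<eta> z w1 \<tau> - \<eta> *\<^sub>R g (assg_c_iterate g C \<eta> z w1 \<tau>) (z \<tau>))"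
  by auto

lemma assg_r_iterate_simps:
  "assg_r_iterate g \<K> \<beta> z w1 (Suc 0) = w1"
  "1 \<le> \<tau> \<Longrightarrow> assg_r_iterate g \<K> \<beta> z w1 (Suc \<tau>) = closest_point \<K>
     ((1 - 2 / real \<tau>) *\<^sub>R assg_r_iterate g \<K> \<beta> z w1 \<tau> + (2 / real \<tau>) *\<^sub>R w1
       - (2 * \<beta> / real \<tau>) *\<^sub>R g (assg_r_iterate g \<K> \<beta> z w1 \<tau>) (z \<tau>))"
  by auto

declare assg_c_iterate.simps [simp del] assg_r_iterate.simps [simp del]
declare assg_c_iterate_simps [simp] assg_r_iterate_simps [simp]

lemma assg_c_iterate_in:
  assumes "closed C" "w1 \<in> C" "1 \<le> \<tau>"
  shows "assg_c_iterate g C \<eta> z w1 \<tau> \<in> C"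
  using \<open>1 \<le> \<tau>\<close>
proof (induction \<tau> rule: dec_induct)
  case (step m)
  then show ?case using assms by (auto intro!: closest_point_in_set)
qed (use assms in simp)

lemma assg_r_iterate_in:
  assumes "closed \<K>" "w1 \<in> \<K>" "1 \<le> \<tau>"
  shows "assg_r_iterate g \<K> \<beta> z w1 \<tau> \<in> \<K>"
  using \<open>1 \<le> \<tau>\<close>
proof (induction \<tau> rule: dec_induct)
  case (step m)
  then show ?case using assms by (auto intro!: closest_point_in_set)
qed (use assms in simp)

locale stochastic_subgradient =
  bounded_subgradient \<K> F "\<lambda>w. \<integral>s. g w s \<partial>D" G + D: prob_space D
  for \<K> :: "'a::euclidean_space set" and F :: "'a \<Rightarrow> real" and g :: "'a \<Rightarrow> 's \<Rightarrow> 'a"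
    and D :: "'s measure" and G :: real +
  assumes measurable_g [measurable]: "(\<lambda>(w, s). g w s) \<in> borel_measurable (borel \<Otimes>\<^sub>M D)"
    and norm_g_le: "w \<in> \<K> \<Longrightarrow> s \<in> space D \<Longrightarrow> norm (g w s) \<le> G"
    and G_pos: "0 < G"
begin

definition h :: "'a \<Rightarrow> 'a" where "h w = (\<integral>s. g w s \<partial>D)"

lemma measurable_h [measurable]: "h \<in> borel_measurable borel"
  unfolding h_def by (rule D.borel_measurable_lebesgue_integral) simp

lemma measurable_g_compose:
  assumes [measurable]: "W \<in> borel_measurable N" "X \<in> measurable N D"
  shows "(\<lambda>\<omega>. g (W \<omega>) (X \<omega>)) \<in> borel_measurable N"
  using measurable_compose[OF measurable_Pair[OF assms] measurable_g] by simp

text \<open>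
  The scaled martingale difference of one step minus its Hoeffding compensator. The compensator depends
  on the current distance to the comparison point \<open>u\<close>, so that no a priori bound on this distance is
  needed for the deviation estimate.
\<close>

definition noise :: "real \<Rightarrow> 'a \<Rightarrow> 'a \<Rightarrow> 's \<Rightarrow> real" where
  "noise s u w x = s * ((h w - g w x) \<bullet> (w - u)) - s\<^sup>2 * G\<^sup>2 / 2 * (norm (w - u))\<^sup>2"

text \<open>
  The comparison point of stage \<open>k\<close> is random, but it is determined by the previous stages, and
  \<open>W \<tau>\<close> by them and the first \<open>\<tau> - 1\<close> samples of the stage. So the noise terms of the stage form an
  exponential supermartingale, and Markov's inequality bounds the probability that their sum
  reaches \<open>ln (1 / p)\<close>.
\<close>

lemma stage_noise:
  fixes M :: "'w measure" and K k t :: nat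
  defines "past \<equiv> \<lambda>\<tau>. {1..<k} \<times> {1..<t} \<union> {k} \<times> {1..<\<tau>}"
  assumes "prob_space M" and iid: "iid_copies M D \<xi> ({1..K} \<times> {1..<t})"
    and k: "k \<in> {1..K}" and "1 \<le> t" "0 < s" "0 < p"
    and W: "\<And>\<tau>. 1 \<le> \<tau> \<Longrightarrow> \<tau> < t \<Longrightarrow> W \<tau> \<in> borel_measurable (generated_algebra M D \<xi> (past \<tau>))"
    and WK: "\<And>\<tau> \<omega>. 1 \<le> \<tau> \<Longrightarrow> \<tau> < t \<Longrightarrow> \<omega> \<in> space M \<Longrightarrow> W \<tau> \<omega> \<in> \<K>"
    and U: "U \<in> borel_measurable (generated_algebra M D \<xi> (past 1))"
  defines "bad \<equiv> {\<omega> \<in> space M. ln (1 / p) \<le> (\<Sum>\<tau>=1..<t. noise s (U \<omega>) (W \<tau> \<omega>) (\<xi> (k, \<tau>) \<omega>))}"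
  shows "bad \<in> sets M" "measure M bad \<le> p"
proof -
  interpret M: prob_space M by fact
  let ?I = "{1..K} \<times> {1..<t}"
  have \<xi>: "\<xi> i \<in> measurable M D" if "i \<in> ?I" for i
    using iid that by (auto simp: iid_copies_def M.indep_vars_def)
  have past: "past \<tau> \<subseteq> ?I" "(k, \<tau>) \<in> ?I" "(k, \<tau>) \<notin> past \<tau>" if "1 \<le> \<tau>" "\<tau> < t" for \<tau>
    using that k by (auto simp: past_def)
  define \<phi> where "\<phi> = (\<lambda>((w, u), x). noise s u w x)"
  have \<phi>[measurable]: "\<phi> \<in> borel_measurable ((borel \<Otimes>\<^sub>M borel) \<Otimes>\<^sub>M D)"
    unfolding \<phi>_def noise_def case_prod_beta
    by (intro borel_measurable_diff borel_measurable_times borel_measurable_inner borel_measurable_power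
        borel_measurable_norm borel_measurable_const measurable_g_compose) measurable
  define Y where "Y \<tau> \<omega> = (W \<tau> \<omega>, U \<omega>)" for \<tau> \<omega>
  have adapted: "(\<lambda>\<omega>. (Y m \<omega>, \<Sum>j=1..<m. \<phi> (Y j \<omega>, \<xi> (k, j) \<omega>)))
      \<in> measurable (generated_algebra M D \<xi> (past m)) ((borel \<Otimes>\<^sub>M borel) \<Otimes>\<^sub>M borel)"
    if m: "1 \<le> m" "m < t" for m
  proof -
    let ?A = "generated_algebra M D \<xi> (past m)"
    have \<xi>m: "\<xi> i \<in> measurable M D" if "i \<in> past m" for i using past(1)[OF m] \<xi> that by auto
    have "Y j \<in> measurable ?A (borel \<Otimes>\<^sub>M borel)" if j: "1 \<le> j" "j \<le> m" for j
      unfolding Y_def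
      by (intro measurable_Pair measurable_generated_algebra_mono[OF \<xi>m _ W[of j]]
          measurable_generated_algebra_mono[OF \<xi>m _ U]) (use j m in \<open>auto simp: past_def\<close>)
    moreover have "\<xi> (k, j) \<in> measurable ?A D" if "1 \<le> j" "j < m" for j
      by (rule measurable_generated_algebra[OF \<xi>m]) (use that in \<open>auto simp: past_def\<close>)
    ultimately show ?thesis
      by (intro measurable_Pair borel_measurable_sum measurable_compose[OF measurable_Pair \<phi>])
        (use m in auto)
  qed
  have Y_meas: "Y m \<in> measurable M (borel \<Otimes>\<^sub>M borel)" if m: "1 \<le> m" "m < t" for m
  proof -
    have "(\<lambda>\<omega>. (Y m \<omega>, \<Sum>j=1..<m. \<phi> (Y j \<omega>, \<xi> (k, j) \<omega>))) \<in> measurable M ((borel \<Otimes>\<^sub>M borel) \<Otimes>\<^sub>M borel)"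
      using past[OF m] \<xi> by (intro measurable_from_generated_algebra[OF _ adapted[OF m]]) auto
    from measurable_compose[OF this measurable_fst] show ?thesis by simp
  qed
  have S: "(\<lambda>\<omega>. \<Sum>j=1..<t. \<phi> (Y j \<omega>, \<xi> (k, j) \<omega>)) \<in> borel_measurable M"
    using Y_meas \<xi> past(2) by (intro borel_measurable_sum measurable_compose[OF measurable_Pair \<phi>]) auto
  have "(\<integral>\<^sup>+\<omega>. exp (\<Sum>j=1..<t. \<phi> (Y j \<omega>, \<xi> (k, j) \<omega>)) \<partial>M) \<le> 1"
  proof (rule M.exponential_supermartingale[OF \<phi>, where A = "\<K> \<times> UNIV"])
    show "\<K> \<times> UNIV \<in> sets (borel \<Otimes>\<^sub>M borel)" using K_closed by (intro pair_measureI) auto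
    show "prob_space D" by (rule D.prob_space_axioms)
    fix m assume m: "1 \<le> m" "m < t"
    show "\<xi> (k, m) \<in> measurable M D" using \<xi> past[OF m] by auto
    show "Y m \<in> measurable M (borel \<Otimes>\<^sub>M borel)" by (rule Y_meas[OF m])
    show "distr M ((borel \<Otimes>\<^sub>M borel) \<Otimes>\<^sub>M borel) (\<lambda>\<omega>. (Y m \<omega>, \<Sum>j=1..<m. \<phi> (Y j \<omega>, \<xi> (k, j) \<omega>))) \<Otimes>\<^sub>M D
        = distr M (((borel \<Otimes>\<^sub>M borel) \<Otimes>\<^sub>M borel) \<Otimes>\<^sub>M D)
           (\<lambda>\<omega>. ((Y m \<omega>, \<Sum>j=1..<m. \<phi> (Y j \<omega>, \<xi> (k, j) \<omega>)), \<xi> (k, m) \<omega>))"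
      by (rule M.distr_pair_generated_algebra[OF iid past[OF m] adapted[OF m]])
    fix \<omega> assume "\<omega> \<in> space M"
    then show "Y m \<omega> \<in> \<K> \<times> UNIV" using WK m by (simp add: Y_def)
  next
    fix y :: "'a \<times> 'a" assume "y \<in> \<K> \<times> UNIV"
    then obtain w u where y: "y = (w, u)" "w \<in> \<K>" by auto
    have "g w \<in> borel_measurable D" by (rule measurable_g_compose[of "\<lambda>_. w"]) auto
    from D.hoeffding_inner_product[OF this norm_g_le[OF y(2)] \<open>0 < s\<close>, of "w - u"]
    show "(\<integral>\<^sup>+x. exp (\<phi> (y, x)) \<partial>D) \<le> 1"
      by (simp add: \<phi>_def noise_def y(1) h_def)
  qed fact
  then show "measure M bad \<le> p"
    using M.prob_ge_ln_le[OF S _ \<open>0 < p\<close>] by (simp add: bad_def \<phi>_def Y_def)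
  show "bad \<in> sets M"
    using S by (simp add: bad_def \<phi>_def Y_def)
qed

text \<open>
  Union bound over the stages, each with failure probability \<open>\<delta> / K\<close>.
\<close>

lemma good_event:
  fixes M :: "'w measure" and K t :: nat
  defines "past \<equiv> \<lambda>k \<tau>. {1..<k} \<times> {1..<t} \<union> {k} \<times> {1..<\<tau>}"
  assumes "prob_space M" and iid: "iid_copies M D \<xi> ({1..K} \<times> {1..<t})"
    and "1 \<le> K" "1 \<le> t" "0 < \<delta>" and s: "\<And>k. k \<in> {1..K} \<Longrightarrow> 0 < s k"
    and W: "\<And>k \<tau>. k \<in> {1..K} \<Longrightarrow> 1 \<le> \<tau> \<Longrightarrow> \<tau> < t \<Longrightarrow>
      W k \<tau> \<in> borel_measurable (generated_algebra M D \<xi> (past k \<tau>))"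
    and WK: "\<And>k \<tau> \<omega>. k \<in> {1..K} \<Longrightarrow> 1 \<le> \<tau> \<Longrightarrow> \<tau> < t \<Longrightarrow> \<omega> \<in> space M \<Longrightarrow> W k \<tau> \<omega> \<in> \<K>"
    and U: "\<And>k. k \<in> {1..K} \<Longrightarrow> U k \<in> borel_measurable (generated_algebra M D \<xi> (past k 1))"
  shows "\<exists>E \<in> sets M. 1 - \<delta> \<le> measure M E \<and> (\<forall>\<omega>\<in>E. \<forall>k\<in>{1..K}.
      (\<Sum>\<tau>=1..<t. noise (s k) (U k \<omega>) (W k \<tau> \<omega>) (\<xi> (k, \<tau>) \<omega>)) < ln (1 / (\<delta> / real K)))"
proof -
  interpret M: prob_space M by fact
  define bad where "bad k = {\<omega> \<in> space M. ln (1 / (\<delta> / real K))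
      \<le> (\<Sum>\<tau>=1..<t. noise (s k) (U k \<omega>) (W k \<tau> \<omega>) (\<xi> (k, \<tau>) \<omega>))}" for k
  have bad: "bad k \<in> sets M" "measure M (bad k) \<le> \<delta> / real K" if k: "k \<in> {1..K}" for k
    using stage_noise[OF \<open>prob_space M\<close> iid k \<open>1 \<le> t\<close> s[OF k], of "\<delta> / real K" "W k" "U k"]
      W[OF k] WK[OF k] U[OF k] \<open>0 < \<delta>\<close> \<open>1 \<le> K\<close>
    by (auto simp: bad_def past_def)
  have "measure M (\<Union>k\<in>{1..K}. bad k) \<le> (\<Sum>k\<in>{1..K}. measure M (bad k))"
    using bad by (intro M.finite_measure_subadditive_finite) auto
  also have "\<dots> \<le> (\<Sum>k\<in>{1..K}. \<delta> / real K)" using bad by (intro sum_mono) auto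
  also have "\<dots> = \<delta>" using \<open>1 \<le> K\<close> by simp
  finally have "1 - \<delta> \<le> measure M (space M - (\<Union>k\<in>{1..K}. bad k))"
    using bad by (subst M.prob_compl) auto
  then show ?thesis using bad
    by (intro bexI[of _ "space M - (\<Union>k\<in>{1..K}. bad k)"]) (auto simp: bad_def not_le)
qed

end

section \<open>A single stage of the algorithms\<close>

context stochastic_subgradient
begin

lemma noise_sum_less_iff:
  assumes "0 < s"
  shows "(\<Sum>\<tau>\<in>A. noise s u (W \<tau>) (z \<tau>)) < L \<longleftrightarrow>
    (\<Sum>\<tau>\<in>A. (h (W \<tau>) - g (W \<tau>) (z \<tau>)) \<bullet> (W \<tau> - u))
      < L / s + s * G\<^sup>2 / 2 * (\<Sum>\<tau>\<in>A. (norm (W \<tau> - u))\<^sup>2)"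
proof -
  have "(\<Sum>\<tau>\<in>A. noise s u (W \<tau>) (z \<tau>)) = s * ((\<Sum>\<tau>\<in>A. (h (W \<tau>) - g (W \<tau>) (z \<tau>)) \<bullet> (W \<tau> - u))
      - s * G\<^sup>2 / 2 * (\<Sum>\<tau>\<in>A. (norm (W \<tau> - u))\<^sup>2))"
    unfolding noise_def sum_subtractf sum_distrib_left[symmetric]
    by (simp add: power2_eq_square right_diff_distrib)
  then have "(\<Sum>\<tau>\<in>A. noise s u (W \<tau>) (z \<tau>)) < L \<longleftrightarrow>
      (\<Sum>\<tau>\<in>A. (h (W \<tau>) - g (W \<tau>) (z \<tau>)) \<bullet> (W \<tau> - u))
      - s * G\<^sup>2 / 2 * (\<Sum>\<tau>\<in>A. (norm (W \<tau> - u))\<^sup>2) < L / s"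
    using assms by (simp only: pos_less_divide_eq mult.commute[of _ s])
  then show ?thesis by linarith
qed

lemma average_gap_le:
  assumes "1 \<le> t" "\<And>\<tau>. \<tau> \<in> {1..t} \<Longrightarrow> W \<tau> \<in> \<K>" "(\<Sum>\<tau>=1..t. F (W \<tau>) - F u) \<le> real t * b"
  shows "F ((1 / real t) *\<^sub>R (\<Sum>\<tau>=1..t. W \<tau>)) - F u \<le> b"
proof -
  have "(\<Sum>\<tau>=1..t. F (W \<tau>)) \<le> real t * (F u + b)"
    using assms(3) by (simp add: sum_subtractf algebra_simps)
  then have "(\<Sum>\<tau>=1..t. F (W \<tau>)) / real t \<le> F u + b" using \<open>1 \<le> t\<close> by (simp add: field_simps)
  with F_average_le[OF assms(1,2)] show ?thesis by fastforce
qed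

text \<open>
  With step size \<open>2 e / (3 G\<^sup>2)\<close> the distance term and the step size term are at most \<open>e / 3\<close> each per
  step. All iterates and \<open>u\<close> lie in a ball of radius \<open>R\<close>, which bounds the compensator; the scale
  \<open>e / (12 G\<^sup>2 R\<^sup>2)\<close> of the noise makes it \<open>e / 6\<close> and the deviation \<open>L\<close> at most \<open>e / 36\<close> per step, for a
  total below \<open>e\<close>.
\<close>

lemma assg_c_stage:
  fixes R e :: real and w1 :: 'a and z :: "nat \<Rightarrow> 's"
  defines "W \<equiv> assg_c_iterate g (\<K> \<inter> cball w1 R) (2 * e / (3 * G\<^sup>2)) z w1"
  assumes "w1 \<in> \<K>" "0 < R" "0 < e" "1 \<le> t" and u: "u \<in> \<K> \<inter> cball w1 R"
    and z: "\<And>\<tau>. 1 \<le> \<tau> \<Longrightarrow> \<tau> < t \<Longrightarrow> z \<tau> \<in> space D"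
    and t: "max 9 (1728 * L) * (G\<^sup>2 * R\<^sup>2 / (4 * e\<^sup>2)) \<le> real t"
    and good: "(\<Sum>\<tau>=1..<t. noise (e / (12 * G\<^sup>2 * R\<^sup>2)) u (W \<tau>) (z \<tau>)) < L"
  shows "F ((1 / real t) *\<^sub>R (\<Sum>\<tau>=1..t. W \<tau>)) - F u \<le> e"
proof -
  let ?C = "\<K> \<inter> cball w1 R" and ?\<eta> = "2 * e / (3 * G\<^sup>2)" and ?s = "e / (12 * G\<^sup>2 * R\<^sup>2)"
  let ?B = "G\<^sup>2 * R\<^sup>2 / (4 * e\<^sup>2)"
  have C: "closed ?C" "convex ?C" using K_closed K_convex by (auto intro: closed_Int convex_Int)
  have w1: "w1 \<in> ?C" using \<open>w1 \<in> \<K>\<close> \<open>0 < R\<close> by simp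
  have W: "W \<tau> \<in> ?C" if "1 \<le> \<tau>" for \<tau>
    unfolding W_def using C w1 that by (intro assg_c_iterate_in) auto
  have W1: "W 1 = w1" by (simp add: W_def)
  have s: "0 < ?s" and \<eta>: "0 < ?\<eta>" using \<open>0 < e\<close> \<open>0 < R\<close> G_pos by auto
  have regret: "(\<Sum>\<tau>=1..t. F (W \<tau>) - F u) \<le> (norm (W 1 - u))\<^sup>2 / (2 * ?\<eta>) + real t * (?\<eta> / 2 * G\<^sup>2)
      + (\<Sum>\<tau>=1..<t. (h (W \<tau>) - g (W \<tau>) (z \<tau>)) \<bullet> (W \<tau> - u))"
    unfolding h_def using C u \<eta> \<open>1 \<le> t\<close> W z norm_g_le
    by (intro projected_subgradient_regret[where C = ?C]) (auto simp: W_def)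
  have "9 * ?B \<le> max 9 (1728 * L) * ?B" "1728 * L * ?B \<le> max 9 (1728 * L) * ?B"
    by (intro mult_right_mono; simp)+
  then have t9: "9 * ?B \<le> real t" and tL: "1728 * L * ?B \<le> real t" using t by linarith+
  have "(norm (W 1 - u))\<^sup>2 \<le> R\<^sup>2"
    using u W1 by (intro power_mono) (auto simp: dist_norm)
  then have "(norm (W 1 - u))\<^sup>2 / (2 * ?\<eta>) \<le> R\<^sup>2 / (2 * ?\<eta>)"
    using \<eta> by (intro divide_right_mono) auto
  also have "\<dots> = e / 3 * (9 * ?B)"
    using \<open>0 < e\<close> G_pos by (simp add: field_simps power2_eq_square)
  also have "\<dots> \<le> e / 3 * real t" using t9 \<open>0 < e\<close> by (intro mult_left_mono) auto
  finally have 1: "(norm (W 1 - u))\<^sup>2 / (2 * ?\<eta>) \<le> e / 3 * real t" .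
  have 2: "real t * (?\<eta> / 2 * G\<^sup>2) = e / 3 * real t" using G_pos by simp
  have "(norm (W \<tau> - u))\<^sup>2 \<le> (2 * R)\<^sup>2" if "\<tau> \<in> {1..<t}" for \<tau>
  proof (rule power_mono)
    show "norm (W \<tau> - u) \<le> 2 * R"
      using W[of \<tau>] that u dist_triangle3[of "W \<tau>" u w1] by (auto simp: dist_norm norm_minus_commute)
  qed simp
  then have "(\<Sum>\<tau>=1..<t. (norm (W \<tau> - u))\<^sup>2) \<le> (\<Sum>\<tau>=1..<t. (2 * R)\<^sup>2)" by (rule sum_mono)
  also have "\<dots> \<le> real t * (2 * R)\<^sup>2" by (simp add: mult_right_mono)
  finally have "?s * G\<^sup>2 / 2 * (\<Sum>\<tau>=1..<t. (norm (W \<tau> - u))\<^sup>2) \<le> ?s * G\<^sup>2 / 2 * (real t * (2 * R)\<^sup>2)"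
    using \<open>0 < e\<close> by (intro mult_left_mono) auto
  also have "\<dots> = e / 6 * real t"
    using \<open>0 < R\<close> G_pos by (simp add: field_simps power2_eq_square)
  finally have 3: "?s * G\<^sup>2 / 2 * (\<Sum>\<tau>=1..<t. (norm (W \<tau> - u))\<^sup>2) \<le> e / 6 * real t" .
  have "L / ?s = e / 36 * (1728 * L * ?B)"
    using \<open>0 < e\<close> \<open>0 < R\<close> G_pos by (simp add: field_simps power2_eq_square)
  also have "\<dots> \<le> e / 36 * real t" using tL \<open>0 < e\<close> by (intro mult_left_mono) auto
  finally have 4: "L / ?s \<le> e / 36 * real t" .
  have 5: "0 \<le> e * real t" using \<open>0 < e\<close> by simp
  have 6: "(\<Sum>\<tau>=1..<t. (h (W \<tau>) - g (W \<tau>) (z \<tau>)) \<bullet> (W \<tau> - u)) \<le> e / 36 * real t + e / 6 * real t"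
    using less_le_trans[OF good[unfolded noise_sum_less_iff[OF s]] add_mono[OF 4 3]] by simp
  have "(\<Sum>\<tau>=1..t. F (W \<tau>) - F u)
      \<le> e / 3 * real t + e / 3 * real t + (e / 36 * real t + e / 6 * real t)"
    using order_trans[OF regret add_mono[OF add_mono[OF 1 eq_refl[OF 2]] 6]] .
  then have "(\<Sum>\<tau>=1..t. F (W \<tau>) - F u) \<le> real t * e" using 5 by (simp add: algebra_simps)
  then show ?thesis using \<open>1 \<le> t\<close> W by (intro average_gap_le) auto
qed

text \<open>
  At noise scale \<open>1 / (2 \<beta> G\<^sup>2)\<close> the compensator is exactly the quadratic term that strong convexity left
  in the regret bound, so the two cancel and only the deviation \<open>2 \<beta> G\<^sup>2 L\<close> remains. This replaces an
  inequality of Freedman type with a union bound over variance levels.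
\<close>

lemma assg_r_stage:
  fixes \<beta> e :: real and w1 :: 'a and z :: "nat \<Rightarrow> 's"
  defines "W \<equiv> assg_r_iterate g \<K> \<beta> z w1"
  assumes "w1 \<in> \<K>" "0 < \<beta>" "1 \<le> t" "u \<in> \<K>"
    and z: "\<And>\<tau>. 1 \<le> \<tau> \<Longrightarrow> \<tau> < t \<Longrightarrow> z \<tau> \<in> space D"
    and u: "(norm (u - w1))\<^sup>2 / (2 * \<beta>) \<le> e / 2"
    and t: "\<beta> * G\<^sup>2 * (9 * (1 + ln (real t)) + 2 * L) \<le> e / 2 * real t"
    and good: "(\<Sum>\<tau>=1..<t. noise (1 / (2 * \<beta> * G\<^sup>2)) u (W \<tau>) (z \<tau>)) < L"
  shows "F ((1 / real t) *\<^sub>R (\<Sum>\<tau>=1..t. W \<tau>)) - F u \<le> e"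
proof -
  let ?s = "1 / (2 * \<beta> * G\<^sup>2)"
  have W: "W \<tau> \<in> \<K>" if "1 \<le> \<tau>" for \<tau>
    unfolding W_def using K_closed \<open>w1 \<in> \<K>\<close> that by (intro assg_r_iterate_in) auto
  have W1: "W 1 = w1" by (simp add: W_def)
  have s: "0 < ?s" using \<open>0 < \<beta>\<close> G_pos by auto
  have "(\<Sum>\<tau>=1..t. F (W \<tau>) - F u) \<le> real t * ((norm (u - W 1))\<^sup>2 / (2 * \<beta>))
      + 9 * \<beta> * G\<^sup>2 * (1 + ln (real t)) - (\<Sum>\<tau>=1..<t. (norm (W \<tau> - u))\<^sup>2) / (4 * \<beta>)
      + (\<Sum>\<tau>=1..<t. (h (W \<tau>) - g (W \<tau>) (z \<tau>)) \<bullet> (W \<tau> - u))"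
    unfolding h_def using \<open>0 < \<beta>\<close> \<open>u \<in> \<K>\<close> \<open>1 \<le> t\<close> W z norm_g_le
    by (intro regularized_subgradient_regret) (auto simp: W_def)
  moreover have "?s * G\<^sup>2 / 2 * (\<Sum>\<tau>=1..<t. (norm (W \<tau> - u))\<^sup>2)
      = (\<Sum>\<tau>=1..<t. (norm (W \<tau> - u))\<^sup>2) / (4 * \<beta>)"
    using G_pos \<open>0 < \<beta>\<close> by (simp add: field_simps)
  moreover have "L / ?s = 2 * \<beta> * G\<^sup>2 * L" by simp
  ultimately have "(\<Sum>\<tau>=1..t. F (W \<tau>) - F u) \<le> real t * ((norm (u - w1))\<^sup>2 / (2 * \<beta>))
      + \<beta> * G\<^sup>2 * (9 * (1 + ln (real t)) + 2 * L)"
    using good unfolding noise_sum_less_iff[OF s] W1 by (simp add: algebra_simps)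
  moreover have "real t * ((norm (u - w1))\<^sup>2 / (2 * \<beta>)) \<le> real t * (e / 2)"
    using u by (intro mult_left_mono) auto
  ultimately have "(\<Sum>\<tau>=1..t. F (W \<tau>) - F u) \<le> real t * (e / 2) + e / 2 * real t"
    using t by linarith
  then have "(\<Sum>\<tau>=1..t. F (W \<tau>) - F u) \<le> real t * e" by (simp add: algebra_simps)
  then show ?thesis using \<open>1 \<le> t\<close> W by (intro average_gap_le) auto
qed

lemma measurable_assg_c_iterate:
  assumes w1: "w1 \<in> borel_measurable N" "\<And>\<omega>. \<omega> \<in> space N \<Longrightarrow> w1 \<omega> \<in> \<K>" and "0 < R" "1 \<le> \<tau>"
    and Z: "\<And>\<sigma>. 1 \<le> \<sigma> \<Longrightarrow> \<sigma> < \<tau> \<Longrightarrow> Z \<sigma> \<in> measurable N D"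
  shows "(\<lambda>\<omega>. assg_c_iterate g (\<K> \<inter> cball (w1 \<omega>) R) \<eta> (\<lambda>\<sigma>. Z \<sigma> \<omega>) (w1 \<omega>) \<tau>) \<in> borel_measurable N"
  using \<open>1 \<le> \<tau>\<close> Z
proof (induction \<tau> rule: dec_induct)
  case base
  then show ?case using w1 by simp
next
  case (step m)
  then have W: "(\<lambda>\<omega>. assg_c_iterate g (\<K> \<inter> cball (w1 \<omega>) R) \<eta> (\<lambda>\<sigma>. Z \<sigma> \<omega>) (w1 \<omega>) m) \<in> borel_measurable N"
    by simp
  have "Z m \<in> measurable N D" using step by simp
  then have "(\<lambda>\<omega>. assg_c_iterate g (\<K> \<inter> cball (w1 \<omega>) R) \<eta> (\<lambda>\<sigma>. Z \<sigma> \<omega>) (w1 \<omega>) m - \<eta> *\<^sub>R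
      g (assg_c_iterate g (\<K> \<inter> cball (w1 \<omega>) R) \<eta> (\<lambda>\<sigma>. Z \<sigma> \<omega>) (w1 \<omega>) m) (Z m \<omega>)) \<in> borel_measurable N"
    using W by (intro borel_measurable_diff borel_measurable_scaleR borel_measurable_const measurable_g_compose)
  from borel_measurable_closest_point_moving_cball[OF K_closed K_convex \<open>0 < R\<close> w1(1) this w1(2)]
  show ?case using step(1) by simp
qed

lemma measurable_assg_r_iterate:
  assumes w1: "w1 \<in> borel_measurable N" and "1 \<le> \<tau>"
    and Z: "\<And>\<sigma>. 1 \<le> \<sigma> \<Longrightarrow> \<sigma> < \<tau> \<Longrightarrow> Z \<sigma> \<in> measurable N D"
  shows "(\<lambda>\<omega>. assg_r_iterate g \<K> \<beta> (\<lambda>\<sigma>. Z \<sigma> \<omega>) (w1 \<omega>) \<tau>) \<in> borel_measurable N"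
  using \<open>1 \<le> \<tau>\<close> Z
proof (induction \<tau> rule: dec_induct)
  case base
  then show ?case using w1 by simp
next
  case (step m)
  let ?W = "\<lambda>\<omega>. assg_r_iterate g \<K> \<beta> (\<lambda>\<sigma>. Z \<sigma> \<omega>) (w1 \<omega>) m"
  have W: "?W \<in> borel_measurable N" using step by simp
  have "Z m \<in> measurable N D" using step by simp
  then have "(\<lambda>\<omega>. (1 - 2 / real m) *\<^sub>R ?W \<omega> + (2 / real m) *\<^sub>R w1 \<omega>
      - (2 * \<beta> / real m) *\<^sub>R g (?W \<omega>) (Z m \<omega>)) \<in> borel_measurable N"
    using W w1 by (intro borel_measurable_diff borel_measurable_add borel_measurable_scaleR
        borel_measurable_const measurable_g_compose)
  moreover have "closest_point \<K> \<in> borel_measurable borel"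
    using continuous_on_closest_point[OF K_convex K_closed K_nonempty]
    by (rule borel_measurable_continuous_onI)
  ultimately show ?case using step(1) by (auto intro: measurable_compose)
qed

lemma assg_c_in:
  assumes "w0 \<in> \<K>" "0 < D1" "1 \<le> t"
  shows "assg_c g \<K> G w0 k t D1 \<epsilon>0 \<xi> \<in> \<K>"
proof (induction k)
  case (Suc k)
  let ?w = "assg_c g \<K> G w0 k t D1 \<epsilon>0 \<xi>" and ?C = "\<K> \<inter> cball (assg_c g \<K> G w0 k t D1 \<epsilon>0 \<xi>) (D1 / 2 ^ k)"
  have "assg_c_iterate g ?C \<eta> z ?w \<tau> \<in> ?C" if "1 \<le> \<tau>" for \<eta> z \<tau>
    using Suc K_closed that assms by (intro assg_c_iterate_in) (auto intro: closed_Int)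
  then show ?case
    unfolding assg_c.simps Let_def using assms by (intro average_in_K) auto
qed (use assms in simp)

lemma assg_r_in:
  assumes "w0 \<in> \<K>" "1 \<le> t"
  shows "assg_r g \<K> w0 k t \<beta>1 \<xi> \<in> \<K>"
proof (induction k)
  case (Suc k)
  then show ?case
    unfolding assg_r.simps Let_def using assms K_closed
    by (intro average_in_K assg_r_iterate_in) auto
qed (use assms in simp)

lemma measurable_assg_c:
  assumes "w0 \<in> \<K>" "0 < D1" "1 \<le> t"
    and X: "\<And>i. i \<in> {1..k} \<times> {1..<t} \<Longrightarrow> X i \<in> measurable N D"
  shows "(\<lambda>\<omega>. assg_c g \<K> G w0 k t D1 \<epsilon>0 (\<lambda>i. X i \<omega>)) \<in> borel_measurable N"
  using X
proof (induction k)
  case (Suc k)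
  then have "(\<lambda>\<omega>. assg_c g \<K> G w0 k t D1 \<epsilon>0 (\<lambda>i. X i \<omega>)) \<in> borel_measurable N" by auto
  then show ?case
    unfolding assg_c.simps Let_def using assg_c_in assms Suc.prems
    by (intro borel_measurable_scaleR borel_measurable_sum borel_measurable_const
        measurable_assg_c_iterate) auto
qed simp

lemma measurable_assg_r:
  assumes "1 \<le> t"
    and X: "\<And>i. i \<in> {1..k} \<times> {1..<t} \<Longrightarrow> X i \<in> measurable N D"
  shows "(\<lambda>\<omega>. assg_r g \<K> w0 k t \<beta>1 (\<lambda>i. X i \<omega>)) \<in> borel_measurable N"
  using X
proof (induction k)
  case (Suc k)
  then have "(\<lambda>\<omega>. assg_r g \<K> w0 k t \<beta>1 (\<lambda>i. X i \<omega>)) \<in> borel_measurable N" by auto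
  then show ?case
    unfolding assg_r.simps Let_def using assms Suc.prems
    by (intro borel_measurable_scaleR borel_measurable_sum borel_measurable_const
        measurable_assg_r_iterate) auto
qed simp

end

section \<open>High-probability bounds for the output\<close>

context stochastic_subgradient
begin

text \<open>
  The invariant of both algorithms. The comparison point of a stage has gap at most \<open>a\<close>, so being within
  \<open>\<epsilon>0 / 2 ^ Suc k\<close> of its value is enough for the next stage.
\<close>

lemma level_halving:
  assumes start: "F (w 0) - Fmin \<le> \<epsilon>0" and "0 < a"
    and wK: "\<And>k. w k \<in> \<K>"
    and stage: "\<And>k. k < K \<Longrightarrow> F (w k) - Fmin \<le> a + \<epsilon>0 / 2 ^ k \<Longrightarrow>
      F (w (Suc k)) - F (closest_point (eps_sublevel_set F \<K> a) (w k)) \<le> \<epsilon>0 / 2 ^ Suc k"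
  shows "k \<le> K \<Longrightarrow> F (w k) - Fmin \<le> a + \<epsilon>0 / 2 ^ k"
proof (induction k)
  case 0
  then show ?case using start \<open>0 < a\<close> by simp
next
  case (Suc k)
  have "closest_point (eps_sublevel_set F \<K> a) (w k) \<in> eps_sublevel_set F \<K> a"
    using closed_sublevel sublevel_nonempty \<open>0 < a\<close> by (intro closest_point_in_set) auto
  then show ?case using stage[of k] Suc by (auto simp: eps_sublevel_set_def)
qed

lemma measurable_closest_point_sublevel:
  assumes "w \<in> borel_measurable N" "0 < a"
  shows "(\<lambda>\<omega>. closest_point (eps_sublevel_set F \<K> a) (w \<omega>)) \<in> borel_measurable N"
proof -
  have "closest_point (eps_sublevel_set F \<K> a) \<in> borel_measurable borel"
    using continuous_on_closest_point[OF convex_sublevel closed_sublevel sublevel_nonempty] \<open>0 < a\<close>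
    by (intro borel_measurable_continuous_onI) auto
  with assms(1) show ?thesis by (rule measurable_compose)
qed

text \<open>
  The radius \<open>D1 / 2 ^ k\<close> is at least the bound of \<open>dist_sublevel_le\<close> at gap \<open>a + \<epsilon>0 / 2 ^ k\<close>, hence the ball
  contains the comparison point. Radius and target accuracy are halved together, so one stage length
  serves all stages.
\<close>

lemma assg_c_high_probability:
  fixes M :: "'w measure" and K t :: nat
  assumes "prob_space M" and iid: "iid_copies M D \<xi> ({1..K} \<times> {1..<t})"
    and w0: "w0 \<in> \<K>" "F w0 - Fmin \<le> \<epsilon>0" and "0 < \<epsilon>0" "0 < a" and K: "1 \<le> K" "\<epsilon>0 / 2 ^ K \<le> a" and "0 < \<delta>"
    and eb: "local_error_bound F \<K> a c \<theta>" "0 < c" "0 < \<theta>"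
    and D1: "c * \<epsilon>0 * a powr (\<theta> - 1) \<le> D1"
    and t: "max 9 (1728 * ln (1 / (\<delta> / real K))) * (G\<^sup>2 * D1\<^sup>2 / \<epsilon>0\<^sup>2) \<le> real t"
  shows "\<exists>E \<in> sets M. 1 - \<delta> \<le> measure M E \<and>
    (\<forall>\<omega>\<in>E. F (assg_c g \<K> G w0 K t D1 \<epsilon>0 (\<lambda>i. \<xi> i \<omega>)) - Fmin \<le> 2 * a)"
proof -
  interpret M: prob_space M by fact
  have "0 < c * \<epsilon>0 * a powr (\<theta> - 1)" using \<open>0 < c\<close> \<open>0 < \<epsilon>0\<close> \<open>0 < a\<close> by simp
  with D1 have D1_pos: "0 < D1" by linarith
  have "0 < max 9 (1728 * ln (1 / (\<delta> / real K))) * (G\<^sup>2 * D1\<^sup>2 / \<epsilon>0\<^sup>2)"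
    using G_pos D1_pos \<open>0 < \<epsilon>0\<close> by (intro mult_pos_pos) auto
  with t have t1: "1 \<le> t" by (cases t) auto
  have \<xi>: "\<xi> i \<in> measurable M D" if "i \<in> {1..K} \<times> {1..<t}" for i
    using iid that by (auto simp: iid_copies_def M.indep_vars_def)
  define w where "w k \<omega> = assg_c g \<K> G w0 k t D1 \<epsilon>0 (\<lambda>i. \<xi> i \<omega>)" for k \<omega>
  have wK: "w k \<omega> \<in> \<K>" for k \<omega>
    unfolding w_def using w0(1) D1_pos t1 by (rule assg_c_in)
  \<comment> \<open>Stage \<open>k\<close> starts from \<open>w (k - 1)\<close>, so its radius or regularisation parameter has exponent \<open>k - 1\<close>, its target accuracy exponent \<open>k\<close>.\<close>
  define W where "W k \<tau> \<omega> = assg_c_iterate g (\<K> \<inter> cball (w (k - 1) \<omega>) (D1 / 2 ^ (k - 1)))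
    (\<epsilon>0 / (3 * G\<^sup>2) / 2 ^ (k - 1)) (\<lambda>\<tau>. \<xi> (k, \<tau>) \<omega>) (w (k - 1) \<omega>) \<tau>" for k \<tau> \<omega>
  define U where "U k \<omega> = closest_point (eps_sublevel_set F \<K> a) (w (k - 1) \<omega>)" for k \<omega>
  define s where "s k = (\<epsilon>0 / 2 ^ k) / (12 * G\<^sup>2 * (D1 / 2 ^ (k - 1))\<^sup>2)" for k :: nat
  let ?past = "\<lambda>k \<tau>. {1..<k} \<times> {1..<t} \<union> {k} \<times> {1..<\<tau>}"
  let ?A = "\<lambda>k \<tau>. generated_algebra M D \<xi> (?past k \<tau>)"
  have coord: "\<xi> i \<in> measurable (?A k \<tau>) D"
    if "k \<in> {1..K}" "\<tau> \<le> t" "i \<in> ?past k \<tau>" for k \<tau> i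
    by (rule measurable_generated_algebra) (use that \<xi> in auto)
  have w_meas: "w (k - 1) \<in> borel_measurable (?A k \<tau>)" if k: "k \<in> {1..K}" "\<tau> \<le> t" for k \<tau>
    unfolding w_def by (rule measurable_assg_c[OF w0(1) D1_pos t1], rule coord[OF k]) (use k in auto)
  have W_meas: "W k \<tau> \<in> borel_measurable (?A k \<tau>)" if k: "k \<in> {1..K}" "1 \<le> \<tau>" "\<tau> < t" for k \<tau>
    unfolding W_def using w_meas[of k \<tau>] wK D1_pos coord[of k \<tau>] k
    by (intro measurable_assg_c_iterate) auto
  have U_meas: "U k \<in> borel_measurable (?A k 1)" if k: "k \<in> {1..K}" for k
    unfolding U_def using w_meas[OF k t1] \<open>0 < a\<close> by (rule measurable_closest_point_sublevel)
  have W_in: "W k \<tau> \<omega> \<in> \<K>" if "1 \<le> \<tau>" for k \<tau> \<omega>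
  proof -
    have "W k \<tau> \<omega> \<in> \<K> \<inter> cball (w (k - 1) \<omega>) (D1 / 2 ^ (k - 1))"
      unfolding W_def using wK D1_pos K_closed that by (intro assg_c_iterate_in) (auto intro: closed_Int)
    then show ?thesis by simp
  qed
  have s_pos: "0 < s k" for k using \<open>0 < \<epsilon>0\<close> G_pos D1_pos by (simp add: s_def)
  have "\<exists>E \<in> sets M. 1 - \<delta> \<le> measure M E \<and> (\<forall>\<omega>\<in>E. \<forall>k\<in>{1..K}.
      (\<Sum>\<tau>=1..<t. noise (s k) (U k \<omega>) (W k \<tau> \<omega>) (\<xi> (k, \<tau>) \<omega>)) < ln (1 / (\<delta> / real K)))"
    by (intro good_event[OF \<open>prob_space M\<close> iid K(1) t1 \<open>0 < \<delta>\<close>] s_pos W_meas W_in U_meas)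
  then obtain E where E: "E \<in> sets M" "1 - \<delta> \<le> measure M E"
    and good: "\<And>\<omega> k. \<omega> \<in> E \<Longrightarrow> k \<in> {1..K} \<Longrightarrow>
      (\<Sum>\<tau>=1..<t. noise (s k) (U k \<omega>) (W k \<tau> \<omega>) (\<xi> (k, \<tau>) \<omega>)) < ln (1 / (\<delta> / real K))"
    by (elim bexE conjE) simp
  have "F (w K \<omega>) - Fmin \<le> 2 * a" if \<omega>: "\<omega> \<in> E" for \<omega>
  proof -
    have \<omega>M: "\<omega> \<in> space M" using E(1) \<omega> sets.sets_into_space by blast
    have "F (w K \<omega>) - Fmin \<le> a + \<epsilon>0 / 2 ^ K"
    proof (rule level_halving[where w = "\<lambda>k. w k \<omega>"])
      show "F (w 0 \<omega>) - Fmin \<le> \<epsilon>0" using w0 by (simp add: w_def)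
      fix k assume k: "k < K" and IH: "F (w k \<omega>) - Fmin \<le> a + \<epsilon>0 / 2 ^ k"
      let ?u = "closest_point (eps_sublevel_set F \<K> a) (w k \<omega>)"
      let ?R = "D1 / 2 ^ k" and ?e = "\<epsilon>0 / 2 ^ Suc k"
      have kK: "Suc k \<in> {1..K}" using k by simp
      have "norm (w k \<omega> - ?u) \<le> c * (\<epsilon>0 / 2 ^ k) * a powr (\<theta> - 1)"
        by (rule dist_sublevel_le[OF wK \<open>0 < a\<close> eb(1) IH]) (use \<open>0 < \<epsilon>0\<close> eb in auto)
      also have "\<dots> = (c * \<epsilon>0 * a powr (\<theta> - 1)) / 2 ^ k" by simp
      also have "\<dots> \<le> ?R" using D1 by (intro divide_right_mono) auto
      finally have dist: "norm (w k \<omega> - ?u) \<le> ?R" .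
      have "?u \<in> eps_sublevel_set F \<K> a"
        using closed_sublevel sublevel_nonempty \<open>0 < a\<close> by (intro closest_point_in_set) auto
      then have u: "?u \<in> \<K> \<inter> cball (w k \<omega>) ?R"
        using dist by (auto simp: dist_norm eps_sublevel_set_def)
      have \<eta>: "\<epsilon>0 / (3 * G\<^sup>2) / 2 ^ k = 2 * ?e / (3 * G\<^sup>2)" by simp
      have R: "G\<^sup>2 * ?R\<^sup>2 / (4 * ?e\<^sup>2) = G\<^sup>2 * D1\<^sup>2 / \<epsilon>0\<^sup>2"
        by (simp add: power_divide field_simps power2_eq_square)
      have W: "W (Suc k) = (\<lambda>\<tau> \<omega>. assg_c_iterate g (\<K> \<inter> cball (w k \<omega>) ?R)
          (2 * ?e / (3 * G\<^sup>2)) (\<lambda>\<tau>. \<xi> (Suc k, \<tau>) \<omega>) (w k \<omega>) \<tau>)"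
        unfolding W_def diff_Suc_1 \<eta> by (rule refl)
      have "F ((1 / real t) *\<^sub>R (\<Sum>\<tau>=1..t. assg_c_iterate g (\<K> \<inter> cball (w k \<omega>) ?R)
          (2 * ?e / (3 * G\<^sup>2)) (\<lambda>\<tau>. \<xi> (Suc k, \<tau>) \<omega>) (w k \<omega>) \<tau>)) - F ?u \<le> ?e"
      proof (rule assg_c_stage[OF wK _ _ t1 u, where L = "ln (1 / (\<delta> / real K))"])
        show "max 9 (1728 * ln (1 / (\<delta> / real K))) * (G\<^sup>2 * ?R\<^sup>2 / (4 * ?e\<^sup>2)) \<le> real t"
          unfolding R by (rule t)
        show "(\<Sum>\<tau>=1..<t. noise (?e / (12 * G\<^sup>2 * ?R\<^sup>2)) ?u (assg_c_iterate g (\<K> \<inter> cball (w k \<omega>) ?R)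
          (2 * ?e / (3 * G\<^sup>2)) (\<lambda>\<tau>. \<xi> (Suc k, \<tau>) \<omega>) (w k \<omega>) \<tau>) (\<xi> (Suc k, \<tau>) \<omega>))
          < ln (1 / (\<delta> / real K))"
          using good[OF \<omega> kK] unfolding W s_def U_def diff_Suc_1 .
        show "\<xi> (Suc k, \<tau>) \<omega> \<in> space D" if "1 \<le> \<tau>" "\<tau> < t" for \<tau>
          using measurable_space[OF \<xi> \<omega>M, of "(Suc k, \<tau>)"] kK that by simp
      qed (use D1_pos \<open>0 < \<epsilon>0\<close> in auto)
      then show "F (w (Suc k) \<omega>) - F ?u \<le> ?e"
        unfolding w_def[of "Suc k"] assg_c.simps Let_def w_def[symmetric] \<eta> .
    qed (use wK \<open>0 < a\<close> in auto)
    then show ?thesis using K(2) by simp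
  qed
  then show ?thesis using E unfolding w_def by blast
qed

text \<open>
  Half of the accuracy \<open>\<epsilon>0 / 2 ^ Suc k\<close> of a stage is spent on the regularisation at the comparison
  point, which is small enough by \<open>dist_sublevel_le\<close> and the choice of \<open>\<beta>1\<close>, the other half on the
  regret.
\<close>

lemma assg_r_high_probability:
  fixes M :: "'w measure" and K t :: nat
  assumes "prob_space M" and iid: "iid_copies M D \<xi> ({1..K} \<times> {1..<t})"
    and w0: "w0 \<in> \<K>" "F w0 - Fmin \<le> \<epsilon>0" and "0 < \<epsilon>0" "0 < a" and K: "1 \<le> K" "\<epsilon>0 / 2 ^ K \<le> a" and "0 < \<delta>"
    and eb: "local_error_bound F \<K> a c \<theta>" "0 < c" "0 < \<theta>"
    and \<beta>1: "2 * c\<^sup>2 * \<epsilon>0 * (a powr (\<theta> - 1))\<^sup>2 \<le> \<beta>1" and t1: "1 \<le> t"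
    and t: "\<beta>1 * G\<^sup>2 * (9 * (1 + ln (real t)) + 2 * ln (1 / (\<delta> / real K))) \<le> \<epsilon>0 / 4 * real t"
  shows "\<exists>E \<in> sets M. 1 - \<delta> \<le> measure M E \<and>
    (\<forall>\<omega>\<in>E. F (assg_r g \<K> w0 K t \<beta>1 (\<lambda>i. \<xi> i \<omega>)) - Fmin \<le> 2 * a)"
proof -
  interpret M: prob_space M by fact
  let ?q = "a powr (\<theta> - 1)"
  have "0 < 2 * c\<^sup>2 * \<epsilon>0 * ?q\<^sup>2" using \<open>0 < c\<close> \<open>0 < \<epsilon>0\<close> \<open>0 < a\<close> by simp
  with \<beta>1 have \<beta>1_pos: "0 < \<beta>1" by linarith
  have \<xi>: "\<xi> i \<in> measurable M D" if "i \<in> {1..K} \<times> {1..<t}" for i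
    using iid that by (auto simp: iid_copies_def M.indep_vars_def)
  define w where "w k \<omega> = assg_r g \<K> w0 k t \<beta>1 (\<lambda>i. \<xi> i \<omega>)" for k \<omega>
  have wK: "w k \<omega> \<in> \<K>" for k \<omega>
    unfolding w_def using w0(1) t1 by (rule assg_r_in)
  \<comment> \<open>Stage \<open>k\<close> starts from \<open>w (k - 1)\<close>, so its radius or regularisation parameter has exponent \<open>k - 1\<close>, its target accuracy exponent \<open>k\<close>.\<close>
  define W where "W k \<tau> \<omega> = assg_r_iterate g \<K> (\<beta>1 / 2 ^ (k - 1)) (\<lambda>\<tau>. \<xi> (k, \<tau>) \<omega>) (w (k - 1) \<omega>) \<tau>"
    for k \<tau> \<omega>
  define U where "U k \<omega> = closest_point (eps_sublevel_set F \<K> a) (w (k - 1) \<omega>)" for k \<omega>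
  define s where "s k = 1 / (2 * (\<beta>1 / 2 ^ (k - 1)) * G\<^sup>2)" for k :: nat
  let ?past = "\<lambda>k \<tau>. {1..<k} \<times> {1..<t} \<union> {k} \<times> {1..<\<tau>}"
  let ?A = "\<lambda>k \<tau>. generated_algebra M D \<xi> (?past k \<tau>)"
  have coord: "\<xi> i \<in> measurable (?A k \<tau>) D"
    if "k \<in> {1..K}" "\<tau> \<le> t" "i \<in> ?past k \<tau>" for k \<tau> i
    by (rule measurable_generated_algebra) (use that \<xi> in auto)
  have w_meas: "w (k - 1) \<in> borel_measurable (?A k \<tau>)" if k: "k \<in> {1..K}" "\<tau> \<le> t" for k \<tau>
    unfolding w_def by (rule measurable_assg_r[OF t1], rule coord[OF k]) (use k in auto)
  have W_meas: "W k \<tau> \<in> borel_measurable (?A k \<tau>)" if k: "k \<in> {1..K}" "1 \<le> \<tau>" "\<tau> < t" for k \<tau>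
    unfolding W_def using w_meas[of k \<tau>] coord[of k \<tau>] k
    by (intro measurable_assg_r_iterate) auto
  have U_meas: "U k \<in> borel_measurable (?A k 1)" if k: "k \<in> {1..K}" for k
    unfolding U_def using w_meas[OF k t1] \<open>0 < a\<close> by (rule measurable_closest_point_sublevel)
  have W_in: "W k \<tau> \<omega> \<in> \<K>" if "1 \<le> \<tau>" for k \<tau> \<omega>
    unfolding W_def using K_closed wK that by (rule assg_r_iterate_in)
  have s_pos: "0 < s k" for k using G_pos \<beta>1_pos by (simp add: s_def)
  have "\<exists>E \<in> sets M. 1 - \<delta> \<le> measure M E \<and> (\<forall>\<omega>\<in>E. \<forall>k\<in>{1..K}.
      (\<Sum>\<tau>=1..<t. noise (s k) (U k \<omega>) (W k \<tau> \<omega>) (\<xi> (k, \<tau>) \<omega>)) < ln (1 / (\<delta> / real K)))"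
    by (intro good_event[OF \<open>prob_space M\<close> iid K(1) t1 \<open>0 < \<delta>\<close>] s_pos W_meas W_in U_meas)
  then obtain E where E: "E \<in> sets M" "1 - \<delta> \<le> measure M E"
    and good: "\<And>\<omega> k. \<omega> \<in> E \<Longrightarrow> k \<in> {1..K} \<Longrightarrow>
      (\<Sum>\<tau>=1..<t. noise (s k) (U k \<omega>) (W k \<tau> \<omega>) (\<xi> (k, \<tau>) \<omega>)) < ln (1 / (\<delta> / real K))"
    by (elim bexE conjE) simp
  have "F (w K \<omega>) - Fmin \<le> 2 * a" if \<omega>: "\<omega> \<in> E" for \<omega>
  proof -
    have \<omega>M: "\<omega> \<in> space M" using E(1) \<omega> sets.sets_into_space by blast
    have "F (w K \<omega>) - Fmin \<le> a + \<epsilon>0 / 2 ^ K"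
    proof (rule level_halving[where w = "\<lambda>k. w k \<omega>"])
      show "F (w 0 \<omega>) - Fmin \<le> \<epsilon>0" using w0 by (simp add: w_def)
      fix k assume k: "k < K" and IH: "F (w k \<omega>) - Fmin \<le> a + \<epsilon>0 / 2 ^ k"
      let ?u = "closest_point (eps_sublevel_set F \<K> a) (w k \<omega>)"
      let ?\<beta> = "\<beta>1 / 2 ^ k" and ?e = "\<epsilon>0 / 2 ^ Suc k"
      have kK: "Suc k \<in> {1..K}" using k by simp
      have "?u \<in> eps_sublevel_set F \<K> a"
        using closed_sublevel sublevel_nonempty \<open>0 < a\<close> by (intro closest_point_in_set) auto
      then have u: "?u \<in> \<K>" by (simp add: eps_sublevel_set_def)
      have "norm (w k \<omega> - ?u) \<le> c * (\<epsilon>0 / 2 ^ k) * ?q"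
        by (rule dist_sublevel_le[OF wK \<open>0 < a\<close> eb(1) IH]) (use \<open>0 < \<epsilon>0\<close> eb in auto)
      then have "(norm (?u - w k \<omega>))\<^sup>2 \<le> (c * (\<epsilon>0 / 2 ^ k) * ?q)\<^sup>2"
        by (intro power_mono) (auto simp: norm_minus_commute)
      also have "\<dots> = (2 * c\<^sup>2 * \<epsilon>0 * ?q\<^sup>2) * ((\<epsilon>0 / 2 ^ k) / (2 * 2 ^ k))"
        by (simp add: power2_eq_square field_simps)
      also have "\<dots> \<le> \<beta>1 * ((\<epsilon>0 / 2 ^ k) / (2 * 2 ^ k))"
        using \<beta>1 \<open>0 < \<epsilon>0\<close> by (intro mult_right_mono) auto
      also have "\<dots> = 2 * ?\<beta> * (?e / 2)" by (simp add: field_simps)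
      finally have dist: "(norm (?u - w k \<omega>))\<^sup>2 / (2 * ?\<beta>) \<le> ?e / 2"
        using \<beta>1_pos by (simp add: field_simps)
      have W: "W (Suc k) = (\<lambda>\<tau> \<omega>. assg_r_iterate g \<K> ?\<beta> (\<lambda>\<tau>. \<xi> (Suc k, \<tau>) \<omega>) (w k \<omega>) \<tau>)"
        unfolding W_def diff_Suc_1 by (rule refl)
      have "F ((1 / real t) *\<^sub>R (\<Sum>\<tau>=1..t. assg_r_iterate g \<K> ?\<beta> (\<lambda>\<tau>. \<xi> (Suc k, \<tau>) \<omega>) (w k \<omega>) \<tau>))
          - F ?u \<le> ?e"
      proof (rule assg_r_stage[OF wK _ t1 u _ dist, where L = "ln (1 / (\<delta> / real K))"])
        have "(\<beta>1 * G\<^sup>2 * (9 * (1 + ln (real t)) + 2 * ln (1 / (\<delta> / real K)))) / 2 ^ k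
            \<le> (\<epsilon>0 / 4 * real t) / 2 ^ k"
          using t by (intro divide_right_mono) auto
        then show "?\<beta> * G\<^sup>2 * (9 * (1 + ln (real t)) + 2 * ln (1 / (\<delta> / real K))) \<le> ?e / 2 * real t"
          by simp
        show "(\<Sum>\<tau>=1..<t. noise (1 / (2 * ?\<beta> * G\<^sup>2)) ?u
            (assg_r_iterate g \<K> ?\<beta> (\<lambda>\<tau>. \<xi> (Suc k, \<tau>) \<omega>) (w k \<omega>) \<tau>) (\<xi> (Suc k, \<tau>) \<omega>))
          < ln (1 / (\<delta> / real K))"
          using good[OF \<omega> kK] unfolding W s_def U_def diff_Suc_1 .
        show "\<xi> (Suc k, \<tau>) \<omega> \<in> space D" if "1 \<le> \<tau>" "\<tau> < t" for \<tau>
          using measurable_space[OF \<xi> \<omega>M, of "(Suc k, \<tau>)"] kK that by simp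
      qed (use \<beta>1_pos in auto)
      then show "F (w (Suc k) \<omega>) - F ?u \<le> ?e"
        unfolding w_def[of "Suc k"] assg_r.simps Let_def w_def[symmetric] .
    qed (use wK \<open>0 < a\<close> in auto)
    then show ?thesis using K(2) by simp
  qed
  then show ?thesis using E unfolding w_def by blast
qed

text \<open>
  For the envelope with parameter \<open>1/4\<close> the squared gradient norm is at most half the gap, that is,
  at most \<open>\<epsilon>\<^sup>2\<close>. The event has to be shown measurable, since \<open>measure\<close> vanishes on other sets.
\<close>

lemma moreau_gradient_event:
  fixes M :: "'w measure"
  assumes "prob_space M" and X: "X \<in> borel_measurable M" and XK: "\<And>\<omega>. X \<omega> \<in> \<K>"
    and E: "E \<in> sets M" "1 - \<delta> \<le> measure M E" "\<And>\<omega>. \<omega> \<in> E \<Longrightarrow> F (X \<omega>) - Fmin \<le> 2 * \<epsilon>\<^sup>2" and "0 < \<epsilon>"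
  shows "1 - \<delta> \<le> measure M {\<omega> \<in> space M.
    \<exists>v. GDERIV (moreau_envelope F \<K> (1/4)) (X \<omega>) :> v \<and> norm v \<le> \<epsilon>}"
proof -
  interpret M: prob_space M by fact
  let ?T = "{\<omega> \<in> space M. 1 / 4 * norm (X \<omega> - prox (1/4) (X \<omega>)) \<le> \<epsilon>}"
  have "prox (1/4) \<in> borel_measurable borel"
    by (rule borel_measurable_continuous_onI) (simp add: continuous_on_prox)
  note measurable_compose[OF X this, measurable] and X[measurable]
  have "?T \<in> sets M" by measurable
  moreover have "E \<subseteq> ?T"
  proof
    fix \<omega> assume \<omega>: "\<omega> \<in> E"
    have "(1 / 4 * norm (X \<omega> - prox (1/4) (X \<omega>)))\<^sup>2 \<le> 2 * (1/4) * (F (X \<omega>) - Fmin)"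
      by (rule moreau_gradient_le) (use XK in auto)
    also have "\<dots> \<le> \<epsilon>\<^sup>2" using E(3)[OF \<omega>] by simp
    finally have "1 / 4 * norm (X \<omega> - prox (1/4) (X \<omega>)) \<le> \<epsilon>"
      by (rule power2_le_imp_le) (use \<open>0 < \<epsilon>\<close> in simp)
    then show "\<omega> \<in> ?T" using \<omega> E(1) sets.sets_into_space by auto
  qed
  ultimately have "measure M E \<le> measure M ?T" by (intro M.finite_measure_mono) auto
  then show ?thesis using E(2) moreau_gradient_small_iff[of "1/4"] by simp
qed

end


section \<open>Iteration complexity\<close>

lemma stage_count:
  fixes \<epsilon> \<epsilon>0 :: real
  assumes \<epsilon>: "0 < \<epsilon>" "\<epsilon> < 1" "\<epsilon>\<^sup>2 < \<epsilon>0" and K: "K = nat \<lceil>log 2 (\<epsilon>0 / \<epsilon>\<^sup>2)\<rceil>"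
  shows "1 \<le> K" "\<epsilon>0 / 2 ^ K \<le> \<epsilon>\<^sup>2" "real K \<le> (2 * \<bar>ln \<epsilon>0\<bar> + 4) * (1 + ln (1 / \<epsilon>))"
proof -
  have e2: "0 < \<epsilon>\<^sup>2" using \<epsilon> by simp
  have x: "1 < \<epsilon>0 / \<epsilon>\<^sup>2" "0 < \<epsilon>0" using \<epsilon> e2 by (simp, linarith)
  have pos: "0 < log 2 (\<epsilon>0 / \<epsilon>\<^sup>2)" using x by simp
  then show "1 \<le> K" unfolding K by linarith
  have "log 2 (\<epsilon>0 / \<epsilon>\<^sup>2) \<le> real K" unfolding K by linarith
  then have "2 powr log 2 (\<epsilon>0 / \<epsilon>\<^sup>2) \<le> 2 powr real K" by simp
  then have "\<epsilon>0 / \<epsilon>\<^sup>2 \<le> 2 ^ K" using x by (simp add: powr_realpow)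
  then show "\<epsilon>0 / 2 ^ K \<le> \<epsilon>\<^sup>2" using e2 by (simp add: field_simps)
  have l: "0 \<le> ln (1 / \<epsilon>)" using \<epsilon> by simp
  have lnx: "ln (\<epsilon>0 / \<epsilon>\<^sup>2) = ln \<epsilon>0 + 2 * ln (1 / \<epsilon>)"
    using \<epsilon> x by (simp add: ln_div ln_realpow)
  have "log 2 (\<epsilon>0 / \<epsilon>\<^sup>2) \<le> 2 * ln (\<epsilon>0 / \<epsilon>\<^sup>2)"
  proof -
    have "0 \<le> ln (\<epsilon>0 / \<epsilon>\<^sup>2)" using x by simp
    then have "ln (\<epsilon>0 / \<epsilon>\<^sup>2) * 1 \<le> ln (\<epsilon>0 / \<epsilon>\<^sup>2) * (2 * ln 2)"
      using ln2_ge_two_thirds by (intro mult_left_mono) auto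
    then show ?thesis by (simp add: log_def field_simps)
  qed
  then have "real K \<le> 2 * (ln \<epsilon>0 + 2 * ln (1 / \<epsilon>)) + 1" unfolding K lnx[symmetric] using pos by linarith
  also have "\<dots> \<le> 2 * \<bar>ln \<epsilon>0\<bar> + 4 + 4 * ln (1 / \<epsilon>)"
    using abs_ge_self[of "ln \<epsilon>0"] by (simp add: algebra_simps)
  also have "\<dots> \<le> 2 * \<bar>ln \<epsilon>0\<bar> + 4 + (2 * \<bar>ln \<epsilon>0\<bar> + 4) * ln (1 / \<epsilon>)"
    using l by (intro add_left_mono mult_right_mono) auto
  finally show "real K \<le> (2 * \<bar>ln \<epsilon>0\<bar> + 4) * (1 + ln (1 / \<epsilon>))" by (simp add: algebra_simps)
qed

text \<open>
  The confidence per stage is \<open>\<delta> / K\<close>; the additional \<open>ln K\<close> is crudely bounded by \<open>K\<close>, itself logarithmic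
  in \<open>1 / \<epsilon>\<close>.
\<close>

lemma log_confidence_bounds:
  fixes \<delta> k0 L :: real
  assumes "0 < \<delta>" "\<delta> < 1" "1 \<le> K" "real K \<le> k0 * L" "1 \<le> L" "0 \<le> k0"
  shows "0 \<le> ln (1 / (\<delta> / real K))"
    "1 + ln (1 / (\<delta> / real K)) \<le> (k0 + 1) * (L * (1 + ln (1 / \<delta>)))"
proof -
  have y: "ln (1 / (\<delta> / real K)) = ln (real K) + ln (1 / \<delta>)"
    using assms by (simp add: ln_div)
  have d: "0 \<le> ln (1 / \<delta>)" using assms by simp
  show "0 \<le> ln (1 / (\<delta> / real K))" unfolding y using assms d by simp
  have "ln (real K) \<le> real K" using ln_le_minus_one[of "real K"] assms by simp
  then have "1 + ln (1 / (\<delta> / real K)) \<le> k0 * L * 1 + 1 * (1 + ln (1 / \<delta>))"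
    unfolding y using assms by simp
  also have "\<dots> \<le> k0 * L * (1 + ln (1 / \<delta>)) + L * (1 + ln (1 / \<delta>))"
    using assms d by (intro add_mono mult_left_mono mult_right_mono) auto
  finally show "1 + ln (1 / (\<delta> / real K)) \<le> (k0 + 1) * (L * (1 + ln (1 / \<delta>)))"
    by (simp add: algebra_simps)
qed

lemma Least_real_ge:
  fixes X :: real
  assumes "0 \<le> X" "t = (LEAST n::nat. X \<le> real n)"
  shows "X \<le> real t" "real t \<le> X + 1"
proof -
  have c: "X \<le> real (nat \<lceil>X\<rceil>)" by linarith
  then show "X \<le> real t" unfolding assms(2) by (rule LeastI)
  have "t \<le> nat \<lceil>X\<rceil>" unfolding assms(2) using c by (rule Least_le)
  then show "real t \<le> X + 1" using assms(1) by linarith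
qed

text \<open>
  The stage length of ASSG-r is defined by an inequality with logarithms of \<open>n\<close> on the right. The
  tangent of the logarithm at \<open>4 b'\<close> gives \<open>b' * (2 * ln n) \<le> n / 2 + 2 * b' * ln (4 * b')\<close>, so every \<open>n\<close>
  above an explicit threshold satisfies it, where \<open>m\<close> stands for a bound of \<open>ln (4 * b')\<close>.
\<close>

lemma log_fixpoint_step:
  fixes b b' y m n :: real
  assumes "0 < b" "b \<le> b'" "0 \<le> y" "3 \<le> n" "ln (4 * b') \<le> m" "2 * b' * (4 + y + 2 * m) \<le> n"
  shows "b * (1 + (ln 4 + ln (ln n) + y) + ln n) \<le> n"
proof -
  have l1: "1 \<le> ln n"
    using assms exp_le by (subst ln_ge_iff) auto
  have b': "0 < b'" using assms by simp
  have "ln (ln n) \<le> ln n" using ln_le_minus_one[of "ln n"] l1 by simp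
  moreover have "ln (4::real) \<le> 3" using ln_le_minus_one[of "4::real"] by simp
  ultimately have "b * (1 + (ln 4 + ln (ln n) + y) + ln n) \<le> b * (4 + y + 2 * ln n)"
    using assms(1) by (intro mult_left_mono) linarith+
  also have "\<dots> \<le> b' * (4 + y + 2 * ln n)"
    using assms l1 by (intro mult_right_mono) auto
  finally have 1: "b * (1 + (ln 4 + ln (ln n) + y) + ln n) \<le> b' * (4 + y + 2 * ln n)" .
  have "ln n \<le> n / (4 * b') + m"
  proof -
    have "ln (n / (4 * b')) \<le> n / (4 * b') - 1"
      using assms b' by (intro ln_le_minus_one) auto
    moreover have "ln (n / (4 * b')) = ln n - ln (4 * b')" using assms b' by (simp add: ln_div)
    ultimately show ?thesis using assms by linarith
  qed
  then have "b' * (4 + y + 2 * ln n) \<le> b' * (4 + y + 2 * (n / (4 * b') + m))"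
    using b' by (intro mult_left_mono) auto
  also have "\<dots> = n / 2 + b' * (4 + y + 2 * m)" using b' by (simp add: field_simps)
  also have "\<dots> \<le> n" using assms by simp
  finally show ?thesis using 1 by simp
qed

lemma complexity_product:
  fixes K t E L \<Delta> T T' k0 :: real
  assumes "0 \<le> K" "K \<le> k0 * L" "0 \<le> t" "t \<le> T * (E * (L * \<Delta>))" "0 \<le> T" "T \<le> T'" "0 \<le> k0"
    "1 \<le> E" "1 \<le> L" "1 \<le> \<Delta>"
  shows "K * t \<le> k0 * T' * E * L ^ 2 * \<Delta> ^ 2"
proof -
  have "K * t \<le> (k0 * L) * (T' * (E * (L * \<Delta>)))"
  proof (rule mult_mono)
    show "t \<le> T' * (E * (L * \<Delta>))"
      using assms by (intro order_trans[OF assms(4)] mult_right_mono) auto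
  qed (use assms in auto)
  also have "\<dots> = (k0 * T' * E * L ^ 2) * \<Delta>" by (simp add: power2_eq_square)
  also have "\<dots> \<le> (k0 * T' * E * L ^ 2) * \<Delta> ^ 2"
    using assms by (intro mult_left_mono self_le_power) auto
  finally show ?thesis .
qed

lemma powr_identities:
  fixes \<epsilon> \<theta> :: real
  assumes "0 < \<epsilon>"
  shows "(\<epsilon>\<^sup>2) powr (\<theta> - 1) = 1 / \<epsilon> powr (2 * (1 - \<theta>))"
    and "(1 / \<epsilon> powr (2 * (1 - \<theta>)))\<^sup>2 = 1 / \<epsilon> powr (4 * (1 - \<theta>))"
proof -
  have "(\<epsilon>\<^sup>2) powr (\<theta> - 1) = (\<epsilon> powr 2) powr (\<theta> - 1)" using assms by simp
  also have "\<dots> = \<epsilon> powr (- (2 * (1 - \<theta>)))" unfolding powr_powr by (simp add: algebra_simps)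
  also have "\<dots> = 1 / \<epsilon> powr (2 * (1 - \<theta>))" by (rule powr_minus_divide)
  finally show "(\<epsilon>\<^sup>2) powr (\<theta> - 1) = 1 / \<epsilon> powr (2 * (1 - \<theta>))" .
  show "(1 / \<epsilon> powr (2 * (1 - \<theta>)))\<^sup>2 = 1 / \<epsilon> powr (4 * (1 - \<theta>))"
    by (simp add: power_divide power2_eq_square powr_add[symmetric] algebra_simps)
qed

lemma inverse_powr_bounds:
  fixes \<epsilon> \<theta> :: real
  assumes "0 < \<epsilon>" "\<epsilon> < 1" "0 < \<theta>" "\<theta> \<le> 1"
  shows "1 \<le> 1 / \<epsilon> powr (4 * (1 - \<theta>))"
    and "ln (1 / \<epsilon> powr (4 * (1 - \<theta>))) \<le> 4 * ln (1 / \<epsilon>)"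
proof -
  show "1 \<le> 1 / \<epsilon> powr (4 * (1 - \<theta>))"
    using assms powr_le1[of "4 * (1 - \<theta>)" \<epsilon>] by simp
  have "ln (1 / \<epsilon> powr (4 * (1 - \<theta>))) = 4 * ((1 - \<theta>) * ln (1 / \<epsilon>))"
    using assms by (simp add: ln_div)
  also have "\<dots> \<le> 4 * (1 * ln (1 / \<epsilon>))"
    using assms by (intro mult_left_mono mult_right_mono) auto
  finally show "ln (1 / \<epsilon> powr (4 * (1 - \<theta>))) \<le> 4 * ln (1 / \<epsilon>)" by simp
qed

text \<open>
  The factor \<open>1 / \<epsilon> powr (4 * (1 - \<theta>))\<close> is the square of the one in the initial radius \<open>D1\<close>.
\<close>

lemma assg_c_stage_length:
  fixes A c G \<epsilon> \<epsilon>0 \<delta> \<theta> D1 k0 :: real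
  defines "E \<equiv> 1 / \<epsilon> powr (4 * (1 - \<theta>))" and "L \<equiv> 1 + ln (1 / \<epsilon>)" and "\<Delta> \<equiv> 1 + ln (1 / \<delta>)"
  assumes \<epsilon>: "0 < \<epsilon>" "\<epsilon> < 1" and \<theta>: "0 < \<theta>" "\<theta> \<le> 1" and "0 < \<epsilon>0" and \<delta>: "0 < \<delta>" "\<delta> < 1"
    and K: "1 \<le> K" "real K \<le> k0 * L" "0 \<le> k0"
    and D1: "0 < D1" "D1 \<le> A * (c * \<epsilon>0 / \<epsilon> powr (2 * (1 - \<theta>)))"
    and t: "t = (LEAST n::nat. real n \<ge>
      max 9 (1728 * ln (1 / (\<delta> / real K))) * (G\<^sup>2 * D1\<^sup>2 / \<epsilon>0\<^sup>2))"
  shows "max 9 (1728 * ln (1 / (\<delta> / real K))) * (G\<^sup>2 * D1\<^sup>2 / \<epsilon>0\<^sup>2) \<le> real t"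
    and "real t \<le> (1728 * (k0 + 1) * (A * c * G)\<^sup>2 + 1) * (E * (L * \<Delta>))"
proof -
  let ?y = "ln (1 / (\<delta> / real K))" and ?B = "G\<^sup>2 * D1\<^sup>2 / \<epsilon>0\<^sup>2"
  have L: "1 \<le> L" and \<Delta>: "1 \<le> \<Delta>" using \<epsilon> \<delta> by (auto simp: L_def \<Delta>_def)
  have E: "1 \<le> E" unfolding E_def using \<epsilon> \<theta> by (rule inverse_powr_bounds)
  have y: "0 \<le> ?y" "1 + ?y \<le> (k0 + 1) * (L * \<Delta>)"
    using log_confidence_bounds[OF \<delta> K(1,2) L K(3)] by (simp_all only: \<Delta>_def)
  have X: "0 \<le> max 9 (1728 * ?y) * ?B" by (intro mult_nonneg_nonneg) auto
  show "max 9 (1728 * ?y) * ?B \<le> real t" using X t by (rule Least_real_ge)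
  have tX: "real t \<le> max 9 (1728 * ?y) * ?B + 1" using X t by (rule Least_real_ge)
  have "D1\<^sup>2 \<le> (A * (c * \<epsilon>0 / \<epsilon> powr (2 * (1 - \<theta>))))\<^sup>2" using D1 by (intro power_mono) auto
  also have "\<dots> = (A * c * \<epsilon>0)\<^sup>2 * (1 / \<epsilon> powr (2 * (1 - \<theta>)))\<^sup>2"
    by (simp add: power_mult_distrib power_divide)
  also have "\<dots> = (A * c * \<epsilon>0)\<^sup>2 * E" unfolding E_def powr_identities[OF \<epsilon>(1)] ..
  finally have "G\<^sup>2 * D1\<^sup>2 / \<epsilon>0\<^sup>2 \<le> G\<^sup>2 * ((A * c * \<epsilon>0)\<^sup>2 * E) / \<epsilon>0\<^sup>2"
    by (intro divide_right_mono mult_left_mono) auto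
  also have "\<dots> = (A * c * G)\<^sup>2 * E" using \<open>0 < \<epsilon>0\<close> by (simp add: power_mult_distrib)
  finally have B: "?B \<le> (A * c * G)\<^sup>2 * E" .
  have "max 9 (1728 * ?y) \<le> 1728 * (1 + ?y)" using y by auto
  also have "\<dots> \<le> 1728 * ((k0 + 1) * (L * \<Delta>))" using y by (intro mult_left_mono) auto
  finally have "max 9 (1728 * ?y) * ?B \<le> 1728 * ((k0 + 1) * (L * \<Delta>)) * ((A * c * G)\<^sup>2 * E)"
    using B K L \<Delta> by (intro mult_mono) auto
  moreover have "1 \<le> E * (L * \<Delta>)" using mult_mono[of 1 E 1 "L * \<Delta>"] mult_mono[of 1 L 1 \<Delta>] E L \<Delta> by simp
  ultimately have "real t \<le> 1728 * ((k0 + 1) * (L * \<Delta>)) * ((A * c * G)\<^sup>2 * E) + E * (L * \<Delta>)"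
    using tX by linarith
  then show "real t \<le> (1728 * (k0 + 1) * (A * c * G)\<^sup>2 + 1) * (E * (L * \<Delta>))"
    by (simp add: algebra_simps)
qed

text \<open>
  An explicit \<open>n\<close> that satisfies the inequality shows that the least one exists and is not larger. The
  inequality at \<open>t\<close> itself, with the nonnegative terms \<open>ln 4\<close> and \<open>ln (ln t)\<close> dropped and 34 replaced by
  9 and 2, is the requirement of the stage analysis.
\<close>

lemma assg_r_stage_length:
  fixes A c G \<epsilon> \<epsilon>0 \<delta> \<theta> \<beta>1 k0 b0 :: real
  defines "E \<equiv> 1 / \<epsilon> powr (4 * (1 - \<theta>))" and "L \<equiv> 1 + ln (1 / \<epsilon>)" and "\<Delta> \<equiv> 1 + ln (1 / \<delta>)"
  assumes \<epsilon>: "0 < \<epsilon>" "\<epsilon> < 1" and \<theta>: "0 < \<theta>" "\<theta> \<le> 1" and "0 < \<epsilon>0" and \<delta>: "0 < \<delta>" "\<delta> < 1" and "0 < G"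
    and K: "1 \<le> K" "real K \<le> k0 * L" "0 \<le> k0"
    and \<beta>1: "0 < \<beta>1" "\<beta>1 \<le> A * (2 * c\<^sup>2 * \<epsilon>0 / \<epsilon> powr (4 * (1 - \<theta>)))"
    and b0: "b0 = 272 * \<bar>A\<bar> * c\<^sup>2 * G\<^sup>2 + 1"
    and t: "t = (LEAST n::nat. real n \<ge> max 3 (136 * \<beta>1 * G\<^sup>2 *
      (1 + ln (4 * ln (real n) / (\<delta> / real K)) + ln (real n)) / \<epsilon>0))"
  shows "3 \<le> t"
    and "\<beta>1 * G\<^sup>2 * (9 * (1 + ln (real t)) + 2 * ln (1 / (\<delta> / real K))) \<le> \<epsilon>0 / 4 * real t"
    and "real t \<le> (4 + 2 * b0 * (13 + 8 * b0 + k0)) * (E * (L * \<Delta>))"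
proof -
  let ?y = "ln (1 / (\<delta> / real K))" and ?l = "ln (1 / \<epsilon>)"
  define b where "b = 136 * \<beta>1 * G\<^sup>2 / \<epsilon>0"
  have L: "1 \<le> L" and \<Delta>: "1 \<le> \<Delta>" using \<epsilon> \<delta> by (auto simp: L_def \<Delta>_def)
  have E: "1 \<le> E" "ln E \<le> 4 * ?l" unfolding E_def using \<epsilon> \<theta> by (rule inverse_powr_bounds)+
  have y: "0 \<le> ?y" "1 + ?y \<le> (k0 + 1) * (L * \<Delta>)"
    using log_confidence_bounds[OF \<delta> K(1,2) L K(3)] by (simp_all only: \<Delta>_def)
  have b: "0 < b" using \<beta>1 \<open>0 < G\<close> \<open>0 < \<epsilon>0\<close> by (simp add: b_def)
  have b0': "1 \<le> b0" by (simp add: b0)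
  have "\<beta>1 \<le> \<bar>A\<bar> * (2 * c\<^sup>2 * \<epsilon>0 * E)"
    using \<beta>1(2) \<open>0 < \<epsilon>0\<close> E(1) mult_right_mono[OF abs_ge_self[of A], of "2 * c\<^sup>2 * \<epsilon>0 * E"]
    by (simp add: E_def)
  then have "b \<le> 136 * (\<bar>A\<bar> * (2 * c\<^sup>2 * \<epsilon>0 * E)) * G\<^sup>2 / \<epsilon>0"
    unfolding b_def using \<open>0 < \<epsilon>0\<close> by (intro divide_right_mono mult_right_mono mult_left_mono) auto
  also have "\<dots> = (272 * \<bar>A\<bar> * c\<^sup>2 * G\<^sup>2) * E" using \<open>0 < \<epsilon>0\<close> by simp
  also have "\<dots> \<le> b0 * E" using E(1) by (intro mult_right_mono) (auto simp: b0)
  finally have bE: "b \<le> b0 * E" .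
  define Q where "Q n \<longleftrightarrow> real n \<ge> max 3 (136 * \<beta>1 * G\<^sup>2 *
      (1 + ln (4 * ln (real n) / (\<delta> / real K)) + ln (real n)) / \<epsilon>0)" for n :: nat
  have t': "t = (LEAST n. Q n)" unfolding t Q_def ..
  have split: "ln (4 * ln (real n) / (\<delta> / real K)) = ln 4 + ln (ln (real n)) + ?y" if "3 \<le> n" for n
  proof -
    have "0 < ln (real n)" using that by simp
    then show ?thesis using \<delta> K by (simp add: ln_div ln_mult)
  qed
  have Q: "Q n \<longleftrightarrow> 3 \<le> n \<and> b * (1 + (ln 4 + ln (ln (real n)) + ?y) + ln (real n)) \<le> real n" for n
  proof (cases "3 \<le> n")
    case True
    then show ?thesis unfolding Q_def split[OF True] b_def by simp
  qed (simp add: Q_def)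
  define m where "m = 4 * b0 + 4 * ?l"
  define Y where "Y = 3 + 2 * (b0 * E) * (4 + ?y + 2 * m)"
  have l: "0 \<le> ?l" using \<epsilon> by simp
  have m: "ln (4 * (b0 * E)) \<le> m"
  proof -
    have "ln (4 * (b0 * E)) = ln (4 * b0) + ln E" using b0' E(1) by (simp add: ln_mult)
    also have "ln (4 * b0) \<le> 4 * b0" using ln_le_minus_one[of "4 * b0"] b0' by simp
    finally show ?thesis using E(2) by (simp add: m_def)
  qed
  have "0 \<le> 2 * (b0 * E) * (4 + ?y + 2 * m)"
    using b0' E(1) y(1) l by (intro mult_nonneg_nonneg) (auto simp: m_def)
  then have Y3: "3 \<le> Y" and Y: "2 * (b0 * E) * (4 + ?y + 2 * m) \<le> Y" by (auto simp: Y_def)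
  have N: "Y \<le> real (nat \<lceil>Y\<rceil>)" "real (nat \<lceil>Y\<rceil>) \<le> Y + 1" using Y3 by linarith+
  have "b * (1 + (ln 4 + ln (ln (real (nat \<lceil>Y\<rceil>))) + ?y) + ln (real (nat \<lceil>Y\<rceil>))) \<le> real (nat \<lceil>Y\<rceil>)"
    by (rule log_fixpoint_step[OF b bE y(1) _ m]) (use N Y Y3 in linarith)+
  moreover have "3 \<le> nat \<lceil>Y\<rceil>" using Y3 by linarith
  ultimately have QN: "Q (nat \<lceil>Y\<rceil>)" unfolding Q by simp
  have Qt: "Q t" unfolding t' using QN by (rule LeastI)
  then show t3: "3 \<le> t" unfolding Q by simp
  have "t \<le> nat \<lceil>Y\<rceil>" unfolding t' using QN by (rule Least_le)
  then have tY: "real t \<le> Y + 1" using N(2) by linarith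
  have l1: "1 \<le> ln (real t)" using t3 exp_le by (subst ln_ge_iff) auto
  show "\<beta>1 * G\<^sup>2 * (9 * (1 + ln (real t)) + 2 * ?y) \<le> \<epsilon>0 / 4 * real t"
  proof -
    have "0 \<le> ln (4::real)" "0 \<le> ln (ln (real t))" using l1 by auto
    then have "9 * (1 + ln (real t)) + 2 * ?y
        \<le> 34 * (1 + (ln 4 + ln (ln (real t)) + ?y) + ln (real t))"
      using l1 y(1) by argo
    then have "\<beta>1 * G\<^sup>2 * (9 * (1 + ln (real t)) + 2 * ?y)
        \<le> \<beta>1 * G\<^sup>2 * (34 * (1 + (ln 4 + ln (ln (real t)) + ?y) + ln (real t)))"
      using \<beta>1 by (intro mult_left_mono) auto
    also have "\<dots> = \<epsilon>0 / 4 * (b * (1 + (ln 4 + ln (ln (real t)) + ?y) + ln (real t)))"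
      using \<open>0 < \<epsilon>0\<close> by (simp add: b_def)
    also have "\<dots> \<le> \<epsilon>0 / 4 * real t"
      using Qt \<open>0 < \<epsilon>0\<close> unfolding Q by (intro mult_left_mono) auto
    finally show ?thesis .
  qed
  have ELD: "1 \<le> E * (L * \<Delta>)" "L \<le> L * \<Delta>"
    using mult_mono[of 1 E 1 "L * \<Delta>"] mult_mono[of 1 L 1 \<Delta>] mult_left_mono[of 1 \<Delta> L] E L \<Delta> by simp_all
  have "4 + ?y + 2 * m \<le> (12 + 8 * b0) * L + (1 + ?y)"
  proof -
    have "0 \<le> 8 * b0 * ?l" "0 \<le> 4 * ?l" using b0' l by auto
    then show ?thesis unfolding m_def L_def by (simp add: algebra_simps)
  qed
  also have "\<dots> \<le> (12 + 8 * b0) * (L * \<Delta>) + (k0 + 1) * (L * \<Delta>)"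
    using ELD(2) b0' y(2) by (intro add_mono mult_left_mono) auto
  also have "\<dots> = (13 + 8 * b0 + k0) * (L * \<Delta>)" by (simp add: algebra_simps)
  finally have "2 * (b0 * E) * (4 + ?y + 2 * m) \<le> 2 * (b0 * E) * ((13 + 8 * b0 + k0) * (L * \<Delta>))"
    using b0' E by (intro mult_left_mono) auto
  then have "real t \<le> 4 * (E * (L * \<Delta>)) + 2 * (b0 * E) * ((13 + 8 * b0 + k0) * (L * \<Delta>))"
    using tY ELD(1) unfolding Y_def by linarith
  then show "real t \<le> (4 + 2 * b0 * (13 + 8 * b0 + k0)) * (E * (L * \<Delta>))"
    by (simp add: algebra_simps)
qed

section \<open>Small gradients of the Moreau envelope\<close>

theorem theorem16:
  fixes \<K> :: "'a::euclidean_space set"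
    and D :: "'s measure"
    and f :: "'a \<Rightarrow> 's \<Rightarrow> real"
    and F :: "'a \<Rightarrow> real"
    and g :: "'a \<Rightarrow> 's \<Rightarrow> 'a"
    and w0 :: 'a
    and \<epsilon>0 G c \<theta> A :: real
  assumes "\<K> \<noteq> {}" and "closed \<K>" and "convex \<K>"
    and "prob_space D"
    and "\<And>s. s \<in> space D \<Longrightarrow> convex_on UNIV (\<lambda>w. f w s)"
    and "\<And>w. w \<in> \<K> \<Longrightarrow> integrable D (f w)"
    and "\<And>w. F w = (\<integral>s. f w s \<partial>D)"
    and "argmin_set F \<K> \<noteq> {}"
    and "(\<lambda>(w, s). g w s) \<in> borel_measurable (borel \<Otimes>\<^sub>M D)"
    and "\<And>w s. w \<in> \<K> \<Longrightarrow> s \<in> space D \<Longrightarrow> is_subgradient_on UNIV (\<lambda>u. f u s) w (g w s)"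
    and "\<And>w. w \<in> \<K> \<Longrightarrow> is_subgradient_on \<K> F w (\<integral>s. g w s \<partial>D)"
    and "w0 \<in> \<K>" and "\<epsilon>0 \<ge> 0" and "F w0 - min_value F \<K> \<le> \<epsilon>0"
    and "G > 0" and "\<And>w s. w \<in> \<K> \<Longrightarrow> s \<in> space D \<Longrightarrow> norm (g w s) \<le> G"
    and "c > 0" and "0 < \<theta>" and "\<theta> \<le> 1"
  shows "\<exists>(C::real) (p::nat). \<forall>(\<epsilon>::real) (\<delta>::real) (K::nat) (t::nat) (M::'w measure)
            (\<xi> :: nat \<times> nat \<Rightarrow> 'w \<Rightarrow> 's) (wK :: 'w \<Rightarrow> 'a).
     0 < \<epsilon> \<and> \<epsilon> < 1 \<and> \<epsilon>\<^sup>2 < \<epsilon>0 \<and> local_error_bound F \<K> (\<epsilon>\<^sup>2) c \<theta> \<and>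
     K = nat \<lceil>log 2 (\<epsilon>0 / \<epsilon>\<^sup>2)\<rceil> \<and>
     prob_space M \<and> iid_copies M D \<xi> ({1..K} \<times> {1..<t}) \<and>
     ((0 < \<delta> \<and> \<delta> < 1 \<and>
       (\<exists>D1. c * \<epsilon>0 / \<epsilon> powr (2 * (1 - \<theta>)) \<le> D1 \<and>
             D1 \<le> A * (c * \<epsilon>0 / \<epsilon> powr (2 * (1 - \<theta>))) \<and>
             t = (LEAST n::nat. real n \<ge>
                    max 9 (1728 * ln (1 / (\<delta> / real K))) * (G\<^sup>2 * D1\<^sup>2 / \<epsilon>0\<^sup>2)) \<and>
             wK = (\<lambda>\<omega>. assg_c g \<K> G w0 K t D1 \<epsilon>0 (\<lambda>i. \<xi> i \<omega>)))) \<or>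
      (0 < \<delta> \<and> \<delta> < 1 / exp 1 \<and>
       (\<exists>\<beta>1. 2 * c\<^sup>2 * \<epsilon>0 / \<epsilon> powr (4 * (1 - \<theta>)) \<le> \<beta>1 \<and>
             \<beta>1 \<le> A * (2 * c\<^sup>2 * \<epsilon>0 / \<epsilon> powr (4 * (1 - \<theta>))) \<and>
             t = (LEAST n::nat. real n \<ge>
                    max 3 (136 * \<beta>1 * G\<^sup>2 *
                      (1 + ln (4 * ln (real n) / (\<delta> / real K)) + ln (real n)) / \<epsilon>0)) \<and>
             wK = (\<lambda>\<omega>. assg_r g \<K> w0 K t \<beta>1 (\<lambda>i. \<xi> i \<omega>)))))
     \<longrightarrow>
     measure M {\<omega> \<in> space M. \<exists>v. GDERIV (moreau_envelope F \<K> (1/4)) (wK \<omega>) :> v \<and> norm v \<le> \<epsilon>}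
       \<ge> 1 - \<delta> \<and>
     real (K * t) \<le>
       C * (1 / \<epsilon> powr (4 * (1 - \<theta>))) * (1 + ln (1 / \<epsilon>)) ^ p * (1 + ln (1 / \<delta>)) ^ p"
proof -
  interpret D: prob_space D by fact
  have g_meas: "g w \<in> borel_measurable D" for w
    using measurable_compose[OF measurable_Pair1' assms(9), of w] by simp
  interpret stochastic_subgradient \<K> F g D G
  proof unfold_locales
    fix w assume w: "w \<in> \<K>"
    have int: "integrable D (g w)"
      by (rule D.integrable_const_bound[of _ G]) (use assms(16)[OF w] g_meas in auto)
    then have "norm (\<integral>s. g w s \<partial>D) \<le> (\<integral>s. norm (g w s) \<partial>D)" by simp
    also have "\<dots> \<le> G"
      using int assms(16)[OF w] by (intro D.integral_le_const) (auto intro: AE_I2)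
    finally show "norm (\<integral>s. g w s \<partial>D) \<le> G" .
  qed (use assms in auto)
  define k0 where "k0 = 2 * \<bar>ln \<epsilon>0\<bar> + 4"
  \<comment> \<open>The summand 1 keeps \<open>b0\<close> positive whatever the constant \<open>A\<close> is.\<close>
  define b0 where "b0 = 272 * \<bar>A\<bar> * c\<^sup>2 * G\<^sup>2 + 1"
  define T1 where "T1 = 1728 * (k0 + 1) * (A * c * G)\<^sup>2 + 1"
  define T2 where "T2 = 4 + 2 * b0 * (13 + 8 * b0 + k0)"
  have T: "0 \<le> k0" "0 \<le> T1" "0 \<le> T2" by (auto simp: k0_def T1_def T2_def b0_def)
  show ?thesis
  proof (intro exI[of _ "k0 * (T1 + T2)"] exI[of _ "2::nat"] allI impI, elim conjE)
    fix \<epsilon> \<delta> :: real and K t :: nat and M :: "'w measure"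
      and \<xi> :: "nat \<times> nat \<Rightarrow> 'w \<Rightarrow> 's" and wK :: "'w \<Rightarrow> 'a"
    assume \<epsilon>: "0 < \<epsilon>" "\<epsilon> < 1" "\<epsilon>\<^sup>2 < \<epsilon>0" and eb: "local_error_bound F \<K> (\<epsilon>\<^sup>2) c \<theta>"
      and K: "K = nat \<lceil>log 2 (\<epsilon>0 / \<epsilon>\<^sup>2)\<rceil>" and M: "prob_space M"
      and iid: "iid_copies M D \<xi> ({1..K} \<times> {1..<t})"
      and alg: "(0 < \<delta> \<and> \<delta> < 1 \<and>
       (\<exists>D1. c * \<epsilon>0 / \<epsilon> powr (2 * (1 - \<theta>)) \<le> D1 \<and>
             D1 \<le> A * (c * \<epsilon>0 / \<epsilon> powr (2 * (1 - \<theta>))) \<and>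
             t = (LEAST n::nat. real n \<ge>
                    max 9 (1728 * ln (1 / (\<delta> / real K))) * (G\<^sup>2 * D1\<^sup>2 / \<epsilon>0\<^sup>2)) \<and>
             wK = (\<lambda>\<omega>. assg_c g \<K> G w0 K t D1 \<epsilon>0 (\<lambda>i. \<xi> i \<omega>)))) \<or>
      (0 < \<delta> \<and> \<delta> < 1 / exp 1 \<and>
       (\<exists>\<beta>1. 2 * c\<^sup>2 * \<epsilon>0 / \<epsilon> powr (4 * (1 - \<theta>)) \<le> \<beta>1 \<and>
             \<beta>1 \<le> A * (2 * c\<^sup>2 * \<epsilon>0 / \<epsilon> powr (4 * (1 - \<theta>))) \<and>
             t = (LEAST n::nat. real n \<ge>
                    max 3 (136 * \<beta>1 * G\<^sup>2 *
                      (1 + ln (4 * ln (real n) / (\<delta> / real K)) + ln (real n)) / \<epsilon>0)) \<and>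
             wK = (\<lambda>\<omega>. assg_r g \<K> w0 K t \<beta>1 (\<lambda>i. \<xi> i \<omega>))))"
    interpret M: prob_space M by fact
    have e2: "0 < \<epsilon>\<^sup>2" "0 < \<epsilon>0" using \<epsilon> by (auto intro: less_trans[of 0 "\<epsilon>\<^sup>2"])
    note K' = stage_count[OF \<epsilon> K, folded k0_def]
    note p = powr_identities[OF \<epsilon>(1), of \<theta>]
    have pos: "0 < c * \<epsilon>0 / \<epsilon> powr (2 * (1 - \<theta>))" "0 < 2 * c\<^sup>2 * \<epsilon>0 / \<epsilon> powr (4 * (1 - \<theta>))"
      using assms(17) e2 \<epsilon> by auto
    have \<xi>: "\<xi> i \<in> measurable M D" if "i \<in> {1..K} \<times> {1..<t}" for i
      using iid that by (auto simp: iid_copies_def M.indep_vars_def)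
    define S where "S = {\<omega> \<in> space M. \<exists>v. GDERIV (moreau_envelope F \<K> (1/4)) (wK \<omega>) :> v \<and> norm v \<le> \<epsilon>}"
    have "1 - \<delta> \<le> measure M S \<and> 0 < \<delta> \<and> \<delta> < 1 \<and>
        (\<exists>T. 0 \<le> T \<and> T \<le> T1 + T2 \<and>
          real t \<le> T * (1 / \<epsilon> powr (4 * (1 - \<theta>)) * ((1 + ln (1 / \<epsilon>)) * (1 + ln (1 / \<delta>)))))"
      using alg
    proof (elim disjE conjE exE)
      fix D1 assume \<delta>: "0 < \<delta>" "\<delta> < 1" and D1: "c * \<epsilon>0 / \<epsilon> powr (2 * (1 - \<theta>)) \<le> D1"
          "D1 \<le> A * (c * \<epsilon>0 / \<epsilon> powr (2 * (1 - \<theta>)))"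
        and t: "t = (LEAST n::nat. real n \<ge>
                    max 9 (1728 * ln (1 / (\<delta> / real K))) * (G\<^sup>2 * D1\<^sup>2 / \<epsilon>0\<^sup>2))"
        and wK: "wK = (\<lambda>\<omega>. assg_c g \<K> G w0 K t D1 \<epsilon>0 (\<lambda>i. \<xi> i \<omega>))"
      have D1_pos: "0 < D1" using pos D1 by linarith
      note len = assg_c_stage_length[OF \<epsilon>(1,2) assms(18,19) e2(2) \<delta> K'(1,3) T(1) D1_pos D1(2) t]
      have "0 < max 9 (1728 * ln (1 / (\<delta> / real K))) * (G\<^sup>2 * D1\<^sup>2 / \<epsilon>0\<^sup>2)"
        using assms(15) D1_pos e2 by (intro mult_pos_pos) auto
      with len(1) have t1: "1 \<le> t" by (cases t) auto
      have "\<exists>E \<in> sets M. 1 - \<delta> \<le> measure M E \<and> (\<forall>\<omega>\<in>E. F (wK \<omega>) - Fmin \<le> 2 * \<epsilon>\<^sup>2)"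
        unfolding wK
        by (rule assg_c_high_probability[OF M iid assms(12,14) e2(2,1) K'(1,2) \<delta>(1) eb assms(17,18)])
          (use D1(1) p len(1) in simp_all)
      then obtain E where E: "E \<in> sets M" "1 - \<delta> \<le> measure M E" "\<And>\<omega>. \<omega> \<in> E \<Longrightarrow> F (wK \<omega>) - Fmin \<le> 2 * \<epsilon>\<^sup>2"
        by blast
      have "1 - \<delta> \<le> measure M S"
        unfolding S_def
      proof (rule moreau_gradient_event[OF M _ _ E \<epsilon>(1)])
        show "wK \<in> borel_measurable M" unfolding wK using assms(12) D1_pos t1 \<xi> by (rule measurable_assg_c)
        show "wK \<omega> \<in> \<K>" for \<omega> unfolding wK using assms(12) D1_pos t1 by (rule assg_c_in)
      qed
      then show ?thesis using \<delta> len(2)[folded T1_def] T by (auto intro!: exI[of _ T1])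
    next
      fix \<beta>1 assume \<delta>: "0 < \<delta>" "\<delta> < 1 / exp 1" and \<beta>1: "2 * c\<^sup>2 * \<epsilon>0 / \<epsilon> powr (4 * (1 - \<theta>)) \<le> \<beta>1"
          "\<beta>1 \<le> A * (2 * c\<^sup>2 * \<epsilon>0 / \<epsilon> powr (4 * (1 - \<theta>)))"
        and t: "t = (LEAST n::nat. real n \<ge> max 3 (136 * \<beta>1 * G\<^sup>2 *
                      (1 + ln (4 * ln (real n) / (\<delta> / real K)) + ln (real n)) / \<epsilon>0))"
        and wK: "wK = (\<lambda>\<omega>. assg_r g \<K> w0 K t \<beta>1 (\<lambda>i. \<xi> i \<omega>))"
      have "1 / exp 1 < (1::real)" by simp
      then have \<delta>1: "\<delta> < 1" using \<delta> by linarith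
      have \<beta>1_pos: "0 < \<beta>1" using pos \<beta>1 by linarith
      note len = assg_r_stage_length[OF \<epsilon>(1,2) assms(18,19) e2(2) \<delta>(1) \<delta>1 assms(15) K'(1,3) T(1)
          \<beta>1_pos \<beta>1(2) b0_def t]
      have t1: "1 \<le> t" using len(1) by simp
      have "\<exists>E \<in> sets M. 1 - \<delta> \<le> measure M E \<and> (\<forall>\<omega>\<in>E. F (wK \<omega>) - Fmin \<le> 2 * \<epsilon>\<^sup>2)"
        unfolding wK
      proof (rule assg_r_high_probability[OF M iid assms(12,14) e2(2,1) K'(1,2) \<delta>(1) eb assms(17,18) _ t1 len(2)])
        show "2 * c\<^sup>2 * \<epsilon>0 * ((\<epsilon>\<^sup>2) powr (\<theta> - 1))\<^sup>2 \<le> \<beta>1" unfolding p using \<beta>1(1) by simp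
      qed
      then obtain E where E: "E \<in> sets M" "1 - \<delta> \<le> measure M E" "\<And>\<omega>. \<omega> \<in> E \<Longrightarrow> F (wK \<omega>) - Fmin \<le> 2 * \<epsilon>\<^sup>2"
        by blast
      have "1 - \<delta> \<le> measure M S"
        unfolding S_def
      proof (rule moreau_gradient_event[OF M _ _ E \<epsilon>(1)])
        show "wK \<in> borel_measurable M" unfolding wK using t1 \<xi> by (rule measurable_assg_r)
        show "wK \<omega> \<in> \<K>" for \<omega> unfolding wK using assms(12) t1 by (rule assg_r_in)
      qed
      then show ?thesis using \<delta>(1) \<delta>1 len(3)[folded T2_def] T by (auto intro!: exI[of _ T2])
    qed
    then obtain T where prob: "1 - \<delta> \<le> measure M S" and \<delta>: "0 < \<delta>" "\<delta> < 1"
      and tT: "0 \<le> T" "T \<le> T1 + T2"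
        "real t \<le> T * (1 / \<epsilon> powr (4 * (1 - \<theta>)) * ((1 + ln (1 / \<epsilon>)) * (1 + ln (1 / \<delta>))))"
      by blast
    have "real K * real t \<le> k0 * (T1 + T2) * (1 / \<epsilon> powr (4 * (1 - \<theta>)))
        * (1 + ln (1 / \<epsilon>)) ^ 2 * (1 + ln (1 / \<delta>)) ^ 2"
      using \<epsilon> \<delta> inverse_powr_bounds(1)[OF \<epsilon>(1,2) assms(18,19)]
      by (intro complexity_product[OF _ K'(3) _ tT(3,1,2) T(1)]) auto
    then show "measure M {\<omega> \<in> space M. \<exists>v. GDERIV (moreau_envelope F \<K> (1/4)) (wK \<omega>) :> v \<and> norm v \<le> \<epsilon>}
        \<ge> 1 - \<delta> \<and>
      real (K * t) \<le> k0 * (T1 + T2) * (1 / \<epsilon> powr (4 * (1 - \<theta>)))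
        * (1 + ln (1 / \<epsilon>)) ^ 2 * (1 + ln (1 / \<delta>)) ^ 2"
      using prob unfolding S_def by simp
  qed
qed

end
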